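(* For $\mu\in\mathbb{R}$ put $s(\mu)=\sqrt{|\mu^2-1|}$ and let $\sigma(\mu)\in\{-1,0,1\}$ be the sign of $\mu^2-1$. For real $\mu_1\le\mu_2$ and signs $\varepsilon_1,\varepsilon_2\in\{+1,-1\}$ let $N(\mu_1,\varepsilon_1;\mu_2,\varepsilon_2)=M_{A,B,C}\in\mathrm{Sp}^{\mathcal I}(4)$ with $$A=\mathrm{diag}(\mu_1,\mu_2),\quad B=\mathrm{diag}(\varepsilon_1s(\mu_1),\varepsilon_2s(\mu_2)),\quad C=\mathrm{diag}(\sigma(\mu_1)\varepsilon_1s(\mu_1),\sigma(\mu_2)\varepsilon_2s(\mu_2)).$$ For $r>0$ and $\theta\in(0,\pi)$ let $N(r,\theta)=M_{A,B,C}\in\mathrm{Sp}^{\mathcal I}(4)$ with $$A=\begin{pmatrix} r\cos\theta & -r\sin\theta \\ r\sin\theta & r\cos\theta \end{pmatrix},\quad B=\begin{pmatrix} 1 & 0 \\ 0 & -1 \end{pmatrix},\quad C=B(A^2-I).$$ Then: (a) Every class in $\mathrm{Sp}^{\mathcal I}(4)//\mathrm{GL}_2(\mathbb{R})$ contains a matrix of the form $N(\mu_1,\varepsilon_1;\mu_2,\varepsilon_2)$ with $\mu_1\le\mu_2$ or of the form $N(r,\theta)$. A class $[M_{A,B,C}]$ for which $A$ has nonreal eigenvalues $re^{\pm i\theta}$ contains exactly one matrix $N(r,\theta)$ and no matrix of the first form. A class $[M_{A,B,C}]$ for which $A$ has real eigenvalues $\mu_1\le\mu_2$ contains only normal forms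 $N(\mu_1,\varepsilon_1;\mu_2,\varepsilon_2)$ with these $\mu_1,\mu_2$; and two such matrices $N(\mu_1,\varepsilon_1;\mu_2,\varepsilon_2)$, $N(\mu_1,\varepsilon_1';\mu_2,\varepsilon_2')$ lie in the same class if and only if they are equal as matrices, or $\mu_1=\mu_2$ and $(\varepsilon_1',\varepsilon_2')=(\varepsilon_2,\varepsilon_1)$. (b) In $\mathrm{Sp}(4)//\mathrm{Sp}(4)$: if $\mu_1<\mu_2$, the classes of $N(\mu_1,\varepsilon_1;\mu_2,\varepsilon_2)$ and $N(\mu_1,\varepsilon_1';\mu_2,\varepsilon_2')$ coincide if and only if $\varepsilon_j=\varepsilon_j'$ for each $j$ with $-1<\mu_j<1$. If $\mu_1=\mu_2=\mu$ with $-1<\mu<1$, they coincide if and only if $\{\varepsilon_1,\varepsilon_2\}=\{\varepsilon_1',\varepsilon_2'\}$ as multisets. If $\mu_1=\mu_2=\mu$ with $|\mu|\ge1$, they always coincide.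
   Context: $\mathrm{Sp}(2n)$ is the group of real symplectic $2n\times 2n$ matrices, i.e. $M^TJM=J$ with $J=\begin{pmatrix} 0 & I \\ -I & 0 \end{pmatrix}$; it acts on itself by conjugation. $\mathcal I=\begin{pmatrix} I & 0 \\ 0 & -I \end{pmatrix}$ and $\mathrm{Sp}^{\mathcal I}(2n)=\{M\in\mathrm{Sp}(2n):M^{-1}=\mathcal I M\mathcal I\}$. Equivalently, $\mathrm{Sp}^{\mathcal I}(2n)$ consists of the matrices $M_{A,B,C}=\begin{pmatrix} A & B \\ C & A^T \end{pmatrix}$ with $A,B,C\in \mathrm{M}_{n\times n}(\mathbb{R})$ satisfying $B=B^T$, $C=C^T$, $AB=BA^T$, $A^TC=CA$, $A^2-BC=I$. The group $\mathrm{GL}_n(\mathbb{R})$ acts on $\mathrm{Sp}^{\mathcal I}(2n)$ by $R_*(A,B,C)=(RAR^{-1},RBR^T,(R^T)^{-1}CR^{-1})$. For a Lie group $G$ acting on a manifold $X$, the orbit closure relation is $x\sim y\iff \overline{Gx}\cap\overline{Gy}\neq\emptyset$. When it is transitive (as is the case for the actions here), the GIT quotient is $X//G:=X/\sim$ with the quotient topology. $[M_{A,B,C}]$ denotes the class in $\mathrm{Sp}^{\mathcal I}(2n)//\mathrm{GL}_n(\mathbb{R})$. The eigenvalues of $A$ depend only on the class. *)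

theory Defs
  imports "HOL-Analysis.Analysis" "HOL-Library.Multiset"
begin

section \<open>Orbit closure relation and GIT quotient\<close>

definition orbit :: "'g set \<Rightarrow> ('g \<Rightarrow> 'x \<Rightarrow> 'x) \<Rightarrow> 'x \<Rightarrow> 'x set" where
  "orbit G act x = (\<lambda>g. act g x) ` G"

definition orbit_closure_rel :: "'g set \<Rightarrow> ('g \<Rightarrow> 'x \<Rightarrow> 'x) \<Rightarrow> 'x topology \<Rightarrow> ('x \<times> 'x) set" where
  "orbit_closure_rel G act X =
     {(x, y). x \<in> topspace X \<and> y \<in> topspace X \<and>
        (X closure_of orbit G act x) \<inter> (X closure_of orbit G act y) \<noteq> {}}"

text \<open>When the orbit closure relation is transitive, it is an equivalence relation on
  \<open>topspace X\<close>, and \<open>git_class\<close> is the equivalence class.\<close>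

definition git_class :: "'g set \<Rightarrow> ('g \<Rightarrow> 'x \<Rightarrow> 'x) \<Rightarrow> 'x topology \<Rightarrow> 'x \<Rightarrow> 'x set" where
  "git_class G act X x = orbit_closure_rel G act X `` {x}"

text \<open>Only the points of the GIT quotient are recorded, not its quotient topology.\<close>

definition git_quotient :: "'g set \<Rightarrow> ('g \<Rightarrow> 'x \<Rightarrow> 'x) \<Rightarrow> 'x topology \<Rightarrow> 'x set set" where
  "git_quotient G act X = topspace X // orbit_closure_rel G act X"


section \<open>Symplectic matrices\<close>

text \<open>A \<open>2n \<times> 2n\<close> matrix is indexed by \<open>'n + 'n\<close>, where \<open>'n\<close> has \<open>n\<close> elements;
  \<open>Inl\<close> indexes the first \<open>n\<close> coordinates and \<open>Inr\<close> the last \<open>n\<close>.\<close>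

type_synonym 'n mat = "((real, 'n) vec, 'n) vec"
type_synonym 'n bmat = "((real, 'n + 'n) vec, 'n + 'n) vec"

definition block :: "'n::finite mat \<Rightarrow> 'n mat \<Rightarrow> 'n mat \<Rightarrow> 'n mat \<Rightarrow> 'n bmat" where
  "block A B C D = (\<chi> i j. case (i, j) of
      (Inl k, Inl l) \<Rightarrow> A $ k $ l
    | (Inl k, Inr l) \<Rightarrow> B $ k $ l
    | (Inr k, Inl l) \<Rightarrow> C $ k $ l
    | (Inr k, Inr l) \<Rightarrow> D $ k $ l)"

definition block_A :: "'n::finite bmat \<Rightarrow> 'n mat" where
  "block_A M = (\<chi> i j. M $ Inl i $ Inl j)"

definition block_B :: "'n::finite bmat \<Rightarrow> 'n mat" where
  "block_B M = (\<chi> i j. M $ Inl i $ Inr j)"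

definition block_C :: "'n::finite bmat \<Rightarrow> 'n mat" where
  "block_C M = (\<chi> i j. M $ Inr i $ Inl j)"

definition J_mat :: "'n::finite bmat" where
  "J_mat = block 0 (mat 1) (- mat 1) 0"

definition I_mat :: "'n::finite bmat" where
  "I_mat = block (mat 1) 0 0 (- mat 1)"

definition Sp :: "'n::finite bmat set" where
  "Sp = {M. transpose M ** J_mat ** M = J_mat}"

definition SpI :: "'n::finite bmat set" where
  "SpI = {M \<in> Sp. matrix_inv M = I_mat ** M ** I_mat}"

definition M_ABC :: "'n::finite mat \<Rightarrow> 'n mat \<Rightarrow> 'n mat \<Rightarrow> 'n bmat" where
  "M_ABC A B C = block A B C (transpose A)"

definition Sp_conj :: "'n::finite bmat \<Rightarrow> 'n bmat \<Rightarrow> 'n bmat" where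
  "Sp_conj S M = S ** M ** matrix_inv S"

definition GL :: "'n::finite mat set" where
  "GL = {R. invertible R}"

definition GL_act :: "'n::finite mat \<Rightarrow> 'n bmat \<Rightarrow> 'n bmat" where
  "GL_act R M = M_ABC (R ** block_A M ** matrix_inv R)
                      (R ** block_B M ** transpose R)
                      (matrix_inv (transpose R) ** block_C M ** matrix_inv R)"

definition SpI_quotient :: "'n::finite bmat set set" where
  "SpI_quotient = git_quotient GL GL_act (top_of_set SpI)"

definition SpI_class :: "'n::finite bmat \<Rightarrow> 'n bmat set" where
  "SpI_class M = git_class GL GL_act (top_of_set SpI) M"

definition Sp_class :: "'n::finite bmat \<Rightarrow> 'n bmat set" where
  "Sp_class M = git_class Sp Sp_conj (top_of_set Sp) M"

text \<open>The complex eigenvalues, without multiplicities. For a \<open>2 \<times> 2\<close> matrix the set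
  already determines the multiplicities.\<close>

definition eigenvalues :: "'n::finite mat \<Rightarrow> complex set" where
  "eigenvalues A = {z. \<exists>v. v \<noteq> 0 \<and> map_matrix complex_of_real A *v v = z *s v}"


section \<open>Normal forms in dimension four\<close>

definition mat22 :: "real \<Rightarrow> real \<Rightarrow> real \<Rightarrow> real \<Rightarrow> 2 mat" where
  "mat22 a b c d = vector [vector [a, b], vector [c, d]]"

definition s_of :: "real \<Rightarrow> real" where
  "s_of \<mu> = sqrt \<bar>\<mu>\<^sup>2 - 1\<bar>"

definition \<sigma>_of :: "real \<Rightarrow> real" where
  "\<sigma>_of \<mu> = sgn (\<mu>\<^sup>2 - 1)"

definition N_real :: "real \<Rightarrow> real \<Rightarrow> real \<Rightarrow> real \<Rightarrow> 2 bmat" where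
  "N_real \<mu>1 \<epsilon>1 \<mu>2 \<epsilon>2 =
     M_ABC (mat22 \<mu>1 0 0 \<mu>2)
           (mat22 (\<epsilon>1 * s_of \<mu>1) 0 0 (\<epsilon>2 * s_of \<mu>2))
           (mat22 (\<sigma>_of \<mu>1 * \<epsilon>1 * s_of \<mu>1) 0 0 (\<sigma>_of \<mu>2 * \<epsilon>2 * s_of \<mu>2))"

definition N_complex :: "real \<Rightarrow> real \<Rightarrow> 2 bmat" where
  "N_complex r \<theta> =
     (let A = mat22 (r * cos \<theta>) (- r * sin \<theta>) (r * sin \<theta>) (r * cos \<theta>);
          B = mat22 1 0 0 (-1)
      in M_ABC A B (B ** (A ** A - mat 1)))"

definition real_forms :: "2 bmat set" where
  "real_forms = {N_real \<mu>1 \<epsilon>1 \<mu>2 \<epsilon>2 | \<mu>1 \<epsilon>1 \<mu>2 \<epsilon>2.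
     \<mu>1 \<le> \<mu>2 \<and> \<epsilon>1 \<in> {1, -1} \<and> \<epsilon>2 \<in> {1, -1}}"

definition complex_forms :: "2 bmat set" where
  "complex_forms = {N_complex r \<theta> | r \<theta>. 0 < r \<and> 0 < \<theta> \<and> \<theta> < pi}"

end

theory Submission
  imports Defs
begin

text \<open>Every implication from a condition on signs to equality of classes is realised inside a
  single orbit. The converses use forms that transform by congruence: \<open>(A - \<nu>)B\<close> for
  the general linear action, and \<open>J(M - M\<^sup>-\<^sup>1)(M + M\<^sup>-\<^sup>1 - \<nu>)\<close> for symplectic conjugation,
  whose sign is the Krein sign of an elliptic eigenvalue. Semidefiniteness passes to orbit closures,
  so at a common limit point of two orbits with opposite signs the form vanishes, which contradicts
  the values of trace and eigenvalues there. For a double eigenvalue the form is nondegenerate in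
  the limit, and definiteness is open. Normal forms are reached by triangularising \<open>A\<close> and scaling the
  off-diagonal and nilpotent parts to zero; trace and determinant of \<open>A\<close> are continuous invariants
  that recover the eigenvalues.\<close>

section \<open>Continuity and algebra of matrix products, inverses, and conjugation
  invariants\<close>

section \<open>Matrix algebra\<close>

text \<open>Equality of classes yields only one point in both orbit closures. It need not be known
  to lie in either orbit, and a form may lose rank there, so signatures cannot be compared directly.
  With distinct eigenvalues, \<nu> is the eigenvalue not under test: A - \<nu> kills its coordinate,
  so the sign of (A - \<nu>)B depends on a single \<epsilon>, whatever the other one is. With a
  double eigenvalue no such factor isolates a sign, but signs then matter only up to order; it is
  enough to recognise pairs of equal signs, where the form is definite. The symplectic forms mirror
  the linear ones. On the fixed point set M + M^-1 = 2 diag(A, A^T), and M - M^-1 has off-diagonal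
  blocks 2B and 2C. For every symplectic M, T = M + M^-1 and K = M - M^-1 satisfy T^2 - K^2 = 4I,
  the analogue of A^2 - BC = I. The two quotients differ because B carries \<epsilon>s on one
  coordinate, while JK carries 2\<epsilon>s(\<sigma>x^2 - y^2) on a plane. The latter is definite
  only for \<sigma> = -1, so hyperbolic signs separate linear classes but not symplectic
  ones.\<close>

lemma bounded_bilinear_matrix_mult:
  "bounded_bilinear ((**) :: real^'n^'m \<Rightarrow> real^'p^'n \<Rightarrow> real^'p^'m)"
  unfolding bilinear_conv_bounded_bilinear[symmetric] bilinear_def
  by (auto intro!: linearI simp: vec_eq_iff matrix_matrix_mult_def sum.distrib
      distrib_left distrib_right sum_distrib_left algebra_simps)

lemma bounded_bilinear_matrix_vector_mult:
  "bounded_bilinear ((*v) :: real^'n^'m \<Rightarrow> real^'n \<Rightarrow> real^'m)"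
  unfolding bilinear_conv_bounded_bilinear[symmetric] bilinear_def
  by (auto intro!: linearI simp: vec_eq_iff matrix_vector_mult_def sum.distrib
      distrib_left distrib_right sum_distrib_left algebra_simps)

lemma bounded_linear_transpose: "bounded_linear (transpose :: real^'n^'m \<Rightarrow> real^'m^'n)"
  unfolding linear_conv_bounded_linear[symmetric]
  by (auto intro!: linearI simp: vec_eq_iff transpose_def)

interpretation matrix_mult: bounded_bilinear
  "(**) :: real^'n^'m \<Rightarrow> real^'p^'n \<Rightarrow> real^'p^'m"
  by (rule bounded_bilinear_matrix_mult)

interpretation matrix_vector_mult: bounded_bilinear
  "(*v) :: real^'n^'m \<Rightarrow> real^'n \<Rightarrow> real^'m"
  by (rule bounded_bilinear_matrix_vector_mult)

lemmas transpose_distribs =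
  linear_add[OF bounded_linear.linear[OF bounded_linear_transpose]]
  linear_diff[OF bounded_linear.linear[OF bounded_linear_transpose]]
  linear_neg[OF bounded_linear.linear[OF bounded_linear_transpose]]
  linear_0[OF bounded_linear.linear[OF bounded_linear_transpose]]
  transpose_scalar

declare matrix_mult.continuous_on [continuous_intros]
  matrix_vector_mult.continuous_on [continuous_intros]
  bounded_linear.continuous_on [OF bounded_linear_transpose, continuous_intros]

lemmas matrix_mult_distribs =
  matrix_mult.add_left matrix_mult.add_right matrix_mult.diff_left matrix_mult.diff_right
  matrix_mult.minus_left matrix_mult.minus_right matrix_mult.scaleR_left matrix_mult.scaleR_right

text \<open>\<open>matrix_inv\<close> is a Hilbert choice; a one-sided inverse of a square real
  matrix is two-sided and unique, which pins the choice down.\<close>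

lemma matrix_inv_eqI:
  fixes A :: "real^'n^'n"
  assumes "A ** B = mat 1"
  shows "matrix_inv A = B"
proof -
  have BA: "B ** A = mat 1"
    using assms matrix_left_right_inverse by blast
  have "A ** matrix_inv A = mat 1 \<and> matrix_inv A ** A = mat 1"
    unfolding matrix_inv_def by (rule someI[of _ B]) (simp add: assms BA)
  then show ?thesis
    by (metis BA matrix_mul_assoc matrix_mul_lid matrix_mul_rid)
qed

lemma matrix_inv_inverse:
  fixes A :: "real^'n^'n"
  assumes "invertible A"
  shows "A ** matrix_inv A = mat 1" "matrix_inv A ** A = mat 1"
  using assms matrix_inv_eqI matrix_left_right_inverse unfolding invertible_def by metis+

lemma invertible_matrix_inv:
  fixes A :: "real^'n^'n"
  shows "invertible A \<Longrightarrow> invertible (matrix_inv A)"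
  using matrix_inv_inverse unfolding invertible_def by blast

lemma matrix_inv_mult:
  fixes A B :: "real^'n^'n"
  assumes "invertible A" "invertible B"
  shows "matrix_inv (A ** B) = matrix_inv B ** matrix_inv A"
proof (rule matrix_inv_eqI)
  have "A ** B ** (matrix_inv B ** matrix_inv A) = A ** (B ** matrix_inv B) ** matrix_inv A"
    by (simp only: matrix_mul_assoc)
  then show "A ** B ** (matrix_inv B ** matrix_inv A) = mat 1"
    by (simp add: matrix_inv_inverse assms)
qed

lemma matrix_inv_transpose:
  fixes A :: "real^'n^'n"
  assumes "invertible A"
  shows "matrix_inv (transpose A) = transpose (matrix_inv A)"
  by (rule matrix_inv_eqI) (simp add: matrix_transpose_mul[symmetric] matrix_inv_inverse assms)

lemma conjugate_mult:
  fixes S :: "real^'n^'n"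
  assumes "invertible S"
  shows "(S ** X ** matrix_inv S) ** (S ** Y ** matrix_inv S) = S ** (X ** Y) ** matrix_inv S"
proof -
  have "(S ** X ** matrix_inv S) ** (S ** Y ** matrix_inv S)
      = S ** X ** (matrix_inv S ** S) ** Y ** matrix_inv S"
    by (simp only: matrix_mul_assoc)
  then show ?thesis
    by (simp add: matrix_inv_inverse assms matrix_mul_assoc)
qed

lemma conjugate_mat_1:
  fixes S :: "real^'n^'n"
  assumes "invertible S"
  shows "S ** (c *\<^sub>R mat 1) ** matrix_inv S = c *\<^sub>R mat 1"
  by (simp add: matrix_mult_distribs matrix_inv_inverse assms)

lemma trace_conjugate:
  fixes S :: "real^'n^'n"
  assumes "invertible S"
  shows "trace (S ** X ** matrix_inv S) = trace X"
  by (simp add: trace_mul_sym[of "S ** X"] matrix_mul_assoc matrix_inv_inverse assms)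

lemma det_conjugate:
  fixes S :: "real^'n^'n"
  assumes "invertible S"
  shows "det (S ** X ** matrix_inv S) = det X"
proof -
  have "det S * det (matrix_inv S) = 1"
    by (metis assms det_I det_mul matrix_inv_inverse(1))
  then show ?thesis
    by (simp add: det_mul)
qed

lemma continuous_on_trace [continuous_intros]:
  fixes f :: "'a::topological_space \<Rightarrow> real^'n^'n"
  shows "continuous_on S f \<Longrightarrow> continuous_on S (\<lambda>x. trace (f x))"
  unfolding trace_def by (intro continuous_intros)

lemma continuous_on_det [continuous_intros]:
  fixes f :: "'a::topological_space \<Rightarrow> real^'n^'n"
  shows "continuous_on S f \<Longrightarrow> continuous_on S (\<lambda>x. det (f x))"
  unfolding det_def by (intro continuous_intros)

section \<open>Semidefinite forms: kernels, limits, and openness of definiteness\<close>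

section \<open>Quadratic forms\<close>

definition qform :: "real^'n^'n \<Rightarrow> real^'n \<Rightarrow> real" where
  "qform X x = x \<bullet> (X *v x)"

lemma continuous_on_qform [continuous_intros]:
  "continuous_on S f \<Longrightarrow> continuous_on S g \<Longrightarrow> continuous_on S (\<lambda>z. qform (f z) (g z))"
  unfolding qform_def by (intro continuous_intros)

lemma qform_congruence: "qform (transpose S ** X ** S) x = qform X (S *v x)"
  unfolding qform_def
  by (metis dot_lmul_matrix inner_commute matrix_vector_mul_assoc transpose_matrix_vector)

lemma qform_scaleR: "qform (c *\<^sub>R X) x = c * qform X x"
  by (simp add: qform_def matrix_vector_mult.scaleR_left)

lemma qform_add:
  assumes "transpose X = X"
  shows "qform X (x + y) = qform X x + 2 * (x \<bullet> (X *v y)) + qform X y"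
proof -
  have "y \<bullet> (X *v x) = x \<bullet> (X *v y)"
    by (metis assms dot_lmul_matrix inner_commute transpose_matrix_vector)
  then show ?thesis
    by (simp add: qform_def matrix_vector_mult.add_right inner_add_left inner_add_right)
qed

text \<open>Polarization: the symmetric bilinear form is recovered from its quadratic form.\<close>

lemma qform_eq_0_imp_eq_0:
  assumes "transpose X = X" "\<And>x. qform X x = 0"
  shows "X = 0"
proof -
  have "x \<bullet> (X *v y) = 0" for x y
    using qform_add[OF assms(1), of x y] assms(2) by simp
  then have "X *v y = 0 *v y" for y
    by (metis inner_eq_zero_iff matrix_vector_mult_0)
  then show ?thesis
    by (metis matrix_eq)
qed

text \<open>For y = Xx, the value of the form at x + ty is a quadratic polynomial in t without
  constant term and with linear coefficient 2|y|^2. It can stay nonnegative on both sides of 0 only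
  if y = 0.\<close>

lemma psd_kernel:
  assumes sym: "transpose X = X" and psd: "\<And>x. 0 \<le> qform X x" and "qform X x = 0"
  shows "X *v x = 0"
proof -
  define y where "y = X *v x"
  have *: "0 \<le> 2 * t * (y \<bullet> y) + t\<^sup>2 * qform X y" for t
  proof -
    have "0 \<le> qform X (x + t *\<^sub>R y)" by (rule psd)
    also have "\<dots> = 2 * (x \<bullet> (X *v (t *\<^sub>R y))) + qform X (t *\<^sub>R y)"
      using qform_add[OF sym, of x "t *\<^sub>R y"] assms(3) by simp
    also have "x \<bullet> (X *v (t *\<^sub>R y)) = t * (y \<bullet> y)"
      by (metis dot_lmul_matrix inner_scaleR_right matrix_vector_mult.scaleR_right sym
          transpose_matrix_vector y_def)
    also have "qform X (t *\<^sub>R y) = t\<^sup>2 * qform X y"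
      by (simp add: qform_def matrix_vector_mult.scaleR_right power2_eq_square)
    finally show ?thesis by simp
  qed
  have q: "0 \<le> qform X y" by (rule psd)
  \<comment> \<open>The minimiser would be -|y|^2 / q(y); the added 1 avoids division by zero and
    still gives a negative value unless y = 0.\<close>
  define t where "t = - (y \<bullet> y) / (1 + qform X y)"
  have "2 * t * (y \<bullet> y) + t\<^sup>2 * qform X y \<le> - (y \<bullet> y)\<^sup>2 / (1 + qform X y)"
  proof -
    have "t\<^sup>2 * qform X y \<le> t\<^sup>2 * (1 + qform X y)" by (simp add: mult_left_mono)
    also have "\<dots> = (y \<bullet> y)\<^sup>2 / (1 + qform X y)"
      using q by (simp add: t_def power2_eq_square)
    finally show ?thesis
      using q by (simp add: t_def power2_eq_square)
  qed
  with *[of t] have "(y \<bullet> y)\<^sup>2 / (1 + qform X y) \<le> 0" by simp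
  then have "y \<bullet> y = 0"
    using q by (simp add: divide_le_0_iff)
  then show ?thesis by (simp add: y_def)
qed

text \<open>The minimum over the compact unit sphere is a uniform positive margin, and a
  perturbation of norm d changes values on the sphere by at most dK. Homogeneity extends the bound
  to all vectors.\<close>

lemma positive_definite_open:
  fixes X :: "real^'n^'n"
  assumes "\<And>x. x \<noteq> 0 \<Longrightarrow> 0 < qform X x"
  obtains e where "0 < e" "\<And>Y x. dist Y X < e \<Longrightarrow> 0 \<le> qform Y x"
proof -
  have "sphere 0 1 \<noteq> ({} :: (real^'n) set)" by simp
  moreover have "continuous_on (sphere 0 1) (qform X)"
    unfolding qform_def by (intro continuous_intros)
  ultimately obtain u where u: "u \<in> sphere 0 1" "\<And>x. x \<in> sphere 0 1 \<Longrightarrow> qform X u \<le> qform X x"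
    by (metis continuous_attains_inf compact_sphere)
  obtain K where K: "0 < K" "\<And>(Y::real^'n^'n) (x::real^'n). norm (Y *v x) \<le> norm Y * norm x * K"
    using matrix_vector_mult.pos_bounded by blast
  have pos: "0 < qform X u" using u(1) assms[of u] by (cases "u = 0") auto
  show ?thesis
  proof (rule that[of "qform X u / K"])
    show "0 < qform X u / K" using pos K(1) by simp
    fix Y x assume d: "dist Y X < qform X u / K"
    have sph: "0 \<le> qform Y v" if v: "v \<in> sphere 0 1" for v
    proof -
      have "\<bar>v \<bullet> ((Y - X) *v v)\<bar> \<le> norm v * norm ((Y - X) *v v)"
        by (rule Cauchy_Schwarz_ineq2)
      also have "\<dots> \<le> dist Y X * K"
        using K(2)[of "Y - X" v] v by (simp add: dist_norm)
      also have "\<dots> \<le> qform X u"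
        using d K(1) by (simp add: field_simps)
      finally show ?thesis
        using u(2)[OF v]
        by (simp add: qform_def matrix_vector_mult.diff_left inner_diff_right)
    qed
    show "0 \<le> qform Y x"
    proof (cases "x = 0")
      case False
      have "0 \<le> qform Y (x /\<^sub>R norm x)"
        using False by (intro sph) simp
      then have "0 \<le> inverse (norm x) * (inverse (norm x) * qform Y x)"
        by (simp add: qform_def matrix_vector_mult.scaleR_right)
      then show ?thesis
        using False by (simp add: zero_le_mult_iff)
    qed (simp add: qform_def)
  qed
qed

text \<open>The vehicle for every passage to a limit: identities are encoded as membership in a
  singleton, inequalities as membership in a half-line.\<close>

lemma closure_map_in_closed:
  assumes "z \<in> closure U" "continuous_on UNIV f" "closed T" "\<And>u. u \<in> U \<Longrightarrow> f u \<in> T"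
  shows "f z \<in> T"
proof -
  have "closed (f -` T)" using assms(2,3) by (simp add: closed_vimage)
  moreover have "U \<subseteq> f -` T" using assms(4) by auto
  ultimately have "closure U \<subseteq> f -` T" by (rule closure_minimal[rotated])
  then show ?thesis using assms(1) by auto
qed

lemma qform_nonneg_closure:
  assumes "z \<in> closure U" "continuous_on UNIV f" "\<And>u x. u \<in> U \<Longrightarrow> 0 \<le> qform (f u) x"
  shows "0 \<le> qform (f z) x"
proof -
  have "qform (f z) x \<in> {0..}"
    using assms by (intro closure_map_in_closed[OF assms(1), of "\<lambda>u. qform (f u) x"])
      (auto intro!: continuous_on_qform)
  then show ?thesis by simp
qed

text \<open>A limit of positive semidefinite forms that is nondegenerate is positive definite, and
  positive definiteness is an open condition.\<close>

lemma nondegenerate_limit_definite: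
  fixes f :: "'a::metric_space \<Rightarrow> real^'n^'n"
  assumes z: "z \<in> closure U" "z \<in> closure V" and f: "continuous_on UNIV f"
    and U: "\<And>u x. u \<in> U \<Longrightarrow> 0 \<le> qform (f u) x"
    and V: "\<And>v. v \<in> V \<Longrightarrow> \<exists>x. qform (f v) x < 0"
    and sym: "transpose (f z) = f z" and ker: "\<And>x. f z *v x = 0 \<Longrightarrow> x = 0"
  shows False
proof -
  have nonneg: "0 \<le> qform (f z) x" for x
    using qform_nonneg_closure[OF z(1) f U] by blast
  have "0 < qform (f z) x" if "x \<noteq> 0" for x
    using psd_kernel[OF sym nonneg, of x] ker[of x] that nonneg[of x] by linarith
  then obtain e where e: "0 < e" "\<And>Y x. dist Y (f z) < e \<Longrightarrow> 0 \<le> qform Y x"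
    using positive_definite_open by blast
  obtain d where d: "0 < d" "\<And>v. dist v z < d \<Longrightarrow> dist (f v) (f z) < e"
    using f e(1) unfolding continuous_on_iff by blast
  obtain v where "v \<in> V" "dist v z < d"
    using z(2) d(1) unfolding closure_approachable by blast
  then have "0 \<le> qform (f v) x" for x
    by (intro e(2) d(2))
  then show False
    using V[OF \<open>v \<in> V\<close>] by (auto simp: not_less[symmetric])
qed

section \<open>Common limit points as witnesses for equality of classes\<close>

section \<open>Orbit closure classes in a subspace\<close>

lemma git_class_iff:
  "y \<in> git_class G act (top_of_set X) x \<longleftrightarrow>
     x \<in> X \<and> y \<in> X \<and> (\<exists>z\<in>X. z \<in> closure (X \<inter> orbit G act x) \<and> z \<in> closure (X \<inter> orbit G act y))"
  by (auto simp: git_class_def orbit_closure_rel_def closure_of_subtopology)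

lemma git_classE:
  assumes "y \<in> git_class G act (top_of_set X) x"
  obtains z where "x \<in> X" "y \<in> X" "z \<in> X"
    "z \<in> closure (orbit G act x)" "z \<in> closure (orbit G act y)"
  using assms closure_mono[of "X \<inter> orbit G act _" "orbit G act _"] unfolding git_class_iff
  by (meson inf_le2 subsetD)

text \<open>Reflexivity at \<open>y\<close> places \<open>y\<close> in the class of
  \<open>x\<close>, which supplies a point adherent to both orbits. All converses use equality of
  classes in this form.\<close>

lemma git_class_eqE:
  assumes "git_class G act (top_of_set X) x = git_class G act (top_of_set X) y"
    and "y \<in> X" "y \<in> orbit G act y"
  obtains z where "z \<in> X" "z \<in> closure (orbit G act x)" "z \<in> closure (orbit G act y)"
proof -
  have "y \<in> git_class G act (top_of_set X) y"
    using assms(2,3) closure_subset[of "X \<inter> orbit G act y"] unfolding git_class_iff by auto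
  then have "y \<in> git_class G act (top_of_set X) x"
    using assms(1) by simp
  then show ?thesis
    by (rule git_classE) (rule that)
qed

lemma git_class_cong_orbit:
  assumes "orbit G act x = orbit G act y" "x \<in> X" "y \<in> X"
  shows "git_class G act (top_of_set X) x = git_class G act (top_of_set X) y"
  using assms by (auto simp: git_class_iff)

text \<open>The limit point \<open>y\<close> itself serves as the common point, being in its own
  orbit.\<close>

lemma closure_orbit_in_git_class:
  assumes "x \<in> X" "y \<in> X" "orbit G act x \<subseteq> X" "y \<in> closure (orbit G act x)" "y \<in> orbit G act y"
  shows "y \<in> git_class G act (top_of_set X) x"
proof -
  have "X \<inter> orbit G act x = orbit G act x" using assms(3) by auto
  moreover have "y \<in> closure (X \<inter> orbit G act y)"
    using assms(2,5) closure_subset[of "X \<inter> orbit G act y"] by auto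
  ultimately show ?thesis
    using assms unfolding git_class_iff by auto
qed

section \<open>Blockwise arithmetic on 2n by 2n matrices\<close>

section \<open>Block matrices\<close>

lemma sum_UNIV_Plus:
  "(\<Sum>i\<in>UNIV. f i) = (\<Sum>i\<in>UNIV. f (Inl i)) + (\<Sum>i\<in>UNIV. f (Inr i))"
  for f :: "'a::finite + 'b::finite \<Rightarrow> 'c::comm_monoid_add"
  using sum.Plus[of UNIV UNIV f] by (simp add: o_def)

lemma all_sum_type: "(\<forall>i::'a + 'b. P i) \<longleftrightarrow> (\<forall>i. P (Inl i)) \<and> (\<forall>i. P (Inr i))"
  by (metis sum.exhaust)

lemma block_nth [simp]:
  "block A B C D $ Inl i $ Inl j = A $ i $ j"
  "block A B C D $ Inl i $ Inr j = B $ i $ j"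
  "block A B C D $ Inr i $ Inl j = C $ i $ j"
  "block A B C D $ Inr i $ Inr j = D $ i $ j"
  by (simp_all add: block_def)

lemma block_eq_iff: "block A B C D = block A' B' C' D' \<longleftrightarrow> A = A' \<and> B = B' \<and> C = C' \<and> D = D'"
  by (auto simp: vec_eq_iff all_sum_type)

lemma block_exhaust:
  obtains A B C D where "M = block A B C D"
proof
  show "M = block (block_A M) (block_B M) (block_C M) (\<chi> i j. M $ Inr i $ Inr j)"
    by (auto simp: vec_eq_iff all_sum_type block_A_def block_B_def block_C_def)
qed

lemma block_ABC [simp]:
  "block_A (block A B C D) = A" "block_B (block A B C D) = B" "block_C (block A B C D) = C"
  by (auto simp: vec_eq_iff block_A_def block_B_def block_C_def)

lemma block_mult:
  "block A B C D ** block A' B' C' D' =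
     block (A ** A' + B ** C') (A ** B' + B ** D') (C ** A' + D ** C') (C ** B' + D ** D')"
  by (auto simp: vec_eq_iff all_sum_type matrix_matrix_mult_def sum_UNIV_Plus)

lemma block_transpose:
  "transpose (block A B C D) = block (transpose A) (transpose C) (transpose B) (transpose D)"
  by (auto simp: vec_eq_iff all_sum_type transpose_def)

lemma block_linear:
  "block A B C D + block A' B' C' D' = block (A + A') (B + B') (C + C') (D + D')"
  "block A B C D - block A' B' C' D' = block (A - A') (B - B') (C - C') (D - D')"
  "- block A B C D = block (- A) (- B) (- C) (- D)"
  "c *\<^sub>R block A B C D = block (c *\<^sub>R A) (c *\<^sub>R B) (c *\<^sub>R C) (c *\<^sub>R D)"
  by (auto simp: vec_eq_iff all_sum_type)

lemma mat_1_block: "mat 1 = block (mat 1) 0 0 (mat 1)"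
  by (auto simp: vec_eq_iff all_sum_type mat_def)

lemma zero_block: "0 = block 0 0 0 0"
  by (auto simp: vec_eq_iff all_sum_type)

lemma trace_block: "trace (block A B C D) = trace A + trace D"
  by (simp add: trace_def sum_UNIV_Plus)

lemmas block_simps = block_mult block_transpose block_linear mat_1_block zero_block block_eq_iff

lemma M_ABC_eq_iff: "M_ABC A B C = M_ABC A' B' C' \<longleftrightarrow> A = A' \<and> B = B' \<and> C = C'"
  by (auto simp: M_ABC_def block_eq_iff)

lemma M_ABC_blocks [simp]:
  "block_A (M_ABC A B C) = A" "block_B (M_ABC A B C) = B" "block_C (M_ABC A B C) = C"
  by (simp_all add: M_ABC_def)

lemma continuous_on_block_ABC [continuous_intros]:
  assumes "continuous_on S f"
  shows "continuous_on S (\<lambda>x. block_A (f x))" "continuous_on S (\<lambda>x. block_B (f x))"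
    "continuous_on S (\<lambda>x. block_C (f x))"
  unfolding block_A_def block_B_def block_C_def using assms by (auto intro!: continuous_intros)

lemma tendsto_M_ABC [tendsto_intros]:
  assumes "(f \<longlongrightarrow> A) F" "(g \<longlongrightarrow> B) F" "(h \<longlongrightarrow> C) F"
  shows "((\<lambda>x. M_ABC (f x) (g x) (h x)) \<longlongrightarrow> M_ABC A B C) F"
proof (intro vec_tendstoI)
  show "((\<lambda>x. M_ABC (f x) (g x) (h x) $ i $ j) \<longlongrightarrow> M_ABC A B C $ i $ j) F" for i j
    by (cases i; cases j) (auto simp: M_ABC_def transpose_def intro!: tendsto_intros assms)
qed

lemma continuous_on_M_ABC [continuous_intros]:
  assumes "continuous_on S f" "continuous_on S g" "continuous_on S h"
  shows "continuous_on S (\<lambda>x. M_ABC (f x) (g x) (h x))"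
  using assms unfolding continuous_on_def by (auto intro!: tendsto_M_ABC)

section \<open>The symplectic inverse, conjugation orbits, and their classes\<close>

section \<open>Symplectic matrices\<close>

lemma J_mat_square: "J_mat ** J_mat = - mat 1"
  by (simp add: J_mat_def block_simps)

lemma transpose_J_mat: "transpose J_mat = - J_mat"
  by (simp add: J_mat_def block_simps transpose_distribs)

text \<open>The inverse of a symplectic matrix, from J^2 = -I. Being linear in the entries, it is
  continuous on all matrices, which is what limit arguments on closures require.\<close>

definition sp_inv :: "'n::finite bmat \<Rightarrow> 'n bmat" where
  "sp_inv M = - (J_mat ** transpose M ** J_mat)"

lemma continuous_on_sp_inv [continuous_intros]:
  "continuous_on S f \<Longrightarrow> continuous_on S (\<lambda>x. sp_inv (f x))"
  unfolding sp_inv_def by (intro continuous_intros)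

lemma sp_inv_left: "M \<in> Sp \<Longrightarrow> sp_inv M ** M = mat 1"
  by (simp add: Sp_def sp_inv_def matrix_mult_distribs matrix_mul_assoc[symmetric] J_mat_square)

lemma sp_inv_right: "M \<in> Sp \<Longrightarrow> M ** sp_inv M = mat 1"
  using sp_inv_left matrix_left_right_inverse by blast

lemma Sp_invertible: "M \<in> Sp \<Longrightarrow> invertible M"
  using sp_inv_left sp_inv_right unfolding invertible_def by blast

lemma matrix_inv_Sp: "M \<in> Sp \<Longrightarrow> matrix_inv M = sp_inv M"
  by (rule matrix_inv_eqI) (rule sp_inv_right)

lemma Sp_mat_1: "mat 1 \<in> Sp"
  by (simp add: Sp_def)

lemma Sp_mult:
  assumes "S \<in> Sp" "T \<in> Sp"
  shows "S ** T \<in> Sp"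
proof -
  have "transpose (S ** T) ** J_mat ** (S ** T) = transpose T ** (transpose S ** J_mat ** S) ** T"
    by (simp only: matrix_transpose_mul matrix_mul_assoc)
  then show ?thesis using assms by (simp add: Sp_def)
qed

lemma Sp_matrix_inv:
  assumes "S \<in> Sp"
  shows "matrix_inv S \<in> Sp"
proof -
  have inv: "S ** matrix_inv S = mat 1"
    using assms by (simp add: Sp_invertible matrix_inv_inverse)
  have "transpose (matrix_inv S) ** (transpose S ** J_mat ** S) ** matrix_inv S
      = transpose (S ** matrix_inv S) ** J_mat ** (S ** matrix_inv S)"
    by (simp only: matrix_transpose_mul matrix_mul_assoc)
  also have "\<dots> = J_mat" by (simp add: inv)
  finally show ?thesis using assms by (simp add: Sp_def)
qed

lemma Sp_conj_Sp: "S \<in> Sp \<Longrightarrow> M \<in> Sp \<Longrightarrow> Sp_conj S M \<in> Sp"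
  unfolding Sp_conj_def by (intro Sp_mult Sp_matrix_inv)

lemma sp_inv_conj:
  assumes "S \<in> Sp" "M \<in> Sp"
  shows "sp_inv (Sp_conj S M) = S ** sp_inv M ** matrix_inv S"
proof -
  have "Sp_conj S M ** (S ** sp_inv M ** matrix_inv S) = mat 1"
    using assms unfolding Sp_conj_def
    by (simp add: conjugate_mult Sp_invertible sp_inv_right matrix_inv_inverse)
  then show ?thesis
    by (metis assms Sp_conj_Sp matrix_inv_Sp matrix_inv_eqI)
qed

lemma Sp_conj_mult:
  assumes "S \<in> Sp" "T \<in> Sp"
  shows "Sp_conj (S ** T) M = Sp_conj S (Sp_conj T M)"
  using assms by (simp add: Sp_conj_def matrix_inv_mult Sp_invertible matrix_mul_assoc)

lemma orbit_Sp_conj: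
  assumes "S \<in> Sp"
  shows "orbit Sp Sp_conj (Sp_conj S M) = orbit Sp Sp_conj M"
proof -
  have "Sp_conj T (Sp_conj S M) \<in> orbit Sp Sp_conj M" if "T \<in> Sp" for T
    using that assms unfolding orbit_def by (metis Sp_conj_mult Sp_mult imageI)
  moreover have "Sp_conj T M \<in> orbit Sp Sp_conj (Sp_conj S M)" if "T \<in> Sp" for T
  proof -
    have "Sp_conj T M = Sp_conj (T ** matrix_inv S) (Sp_conj S M)"
      using that assms
      by (simp add: Sp_conj_mult[symmetric] Sp_mult Sp_matrix_inv matrix_mul_assoc[symmetric]
          matrix_inv_inverse Sp_invertible)
    then show ?thesis
      using that assms unfolding orbit_def by (metis Sp_matrix_inv Sp_mult imageI)
  qed
  ultimately show ?thesis unfolding orbit_def by blast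
qed

text \<open>An intertwining relation stands in for conjugation, so explicit matrices can be checked
  without computing an inverse.\<close>

lemma Sp_class_eqI:
  assumes "S \<in> Sp" "M \<in> Sp" "S ** M = M' ** S"
  shows "Sp_class M = Sp_class M'"
proof -
  have "M' = Sp_conj S M"
    unfolding Sp_conj_def assms(3) using assms(1)
    by (simp add: matrix_mul_assoc[symmetric] matrix_inv_inverse Sp_invertible)
  then show ?thesis
    unfolding Sp_class_def using assms(1,2)
    by (intro git_class_cong_orbit) (simp_all add: orbit_Sp_conj Sp_conj_Sp)
qed

lemma in_orbit_Sp: "M \<in> orbit Sp Sp_conj M"
proof -
  have "M = Sp_conj (mat 1) M"
    by (simp add: Sp_conj_def matrix_inv_eqI[of "mat 1" "mat 1"])
  then show ?thesis unfolding orbit_def using Sp_mat_1 by blast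
qed

section \<open>Equations of the fixed point set, its linear action, degenerations, and
  invariants\<close>

section \<open>The fixed point set and its action\<close>

lemma SpI_imp_M_ABC:
  assumes "M \<in> SpI"
  obtains A B C where "M = M_ABC A B C"
proof -
  obtain A B C D where M: "M = block A B C D" by (rule block_exhaust)
  have "sp_inv M = I_mat ** M ** I_mat"
    using assms by (auto simp: SpI_def matrix_inv_Sp[symmetric])
  then have "D = transpose A"
    by (simp add: M sp_inv_def I_mat_def J_mat_def block_simps matrix_mult_distribs)
  then show ?thesis using that M by (simp add: M_ABC_def)
qed

text \<open>Comparing the blocks of -J M^T J and I M I gives the symmetry of B and C; the remaining
  equations are the blocks of M times I M I = 1.\<close>

lemma SpI_iff:
  "M_ABC A B C \<in> SpI \<longleftrightarrow> transpose B = B \<and> transpose C = C \<and> A ** B = B ** transpose A \<and>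
     transpose A ** C = C ** A \<and> A ** A - B ** C = mat 1"
proof
  assume M: "M_ABC A B C \<in> SpI"
  then have Sp: "M_ABC A B C \<in> Sp" and inv: "sp_inv (M_ABC A B C) = I_mat ** M_ABC A B C ** I_mat"
    by (auto simp: SpI_def matrix_inv_Sp[symmetric])
  have 1: "transpose B = B" "transpose C = C"
    using inv by (simp_all add: M_ABC_def sp_inv_def I_mat_def J_mat_def block_simps
        matrix_mult_distribs)
  have "M_ABC A B C ** (I_mat ** M_ABC A B C ** I_mat) = mat 1"
    using sp_inv_right[OF Sp] inv by simp
  then show "transpose B = B \<and> transpose C = C \<and> A ** B = B ** transpose A \<and>
     transpose A ** C = C ** A \<and> A ** A - B ** C = mat 1"
    using 1 by (simp add: M_ABC_def I_mat_def block_simps matrix_mult_distribs)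
next
  assume *: "transpose B = B \<and> transpose C = C \<and> A ** B = B ** transpose A \<and>
     transpose A ** C = C ** A \<and> A ** A - B ** C = mat 1"
  \<comment> \<open>The transpose of A^2 - BC = I, with B and C symmetric; it is the lower right
    block of the product with the candidate inverse.\<close>
  then have t: "transpose A ** transpose A - C ** B = mat 1"
    by (metis matrix_transpose_mul transpose_distribs(2) transpose_mat)
  have "M_ABC A B C ** (I_mat ** M_ABC A B C ** I_mat) = mat 1"
    using * t by (simp add: M_ABC_def I_mat_def block_simps matrix_mult_distribs)
  moreover have "M_ABC A B C \<in> Sp"
  proof -
    have "B ** C - A ** A = - mat 1"
      using * by (metis minus_diff_eq)
    then show ?thesis
      using * t by (simp add: M_ABC_def Sp_def J_mat_def block_simps matrix_mult_distribs)
  qed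
  ultimately show "M_ABC A B C \<in> SpI"
    by (simp add: SpI_def matrix_inv_eqI)
qed

lemma GL_act_M_ABC:
  "GL_act R (M_ABC A B C) = M_ABC (R ** A ** matrix_inv R) (R ** B ** transpose R)
     (matrix_inv (transpose R) ** C ** matrix_inv R)"
  by (simp add: GL_act_def)

text \<open>An inverse-free certificate for the action: C is expressed through C' rather than
  conversely.\<close>

lemma GL_act_eqI:
  assumes R: "R \<in> GL" and "R ** A = A' ** R" "R ** B ** transpose R = B'" "transpose R ** C' ** R = C"
  shows "GL_act R (M_ABC A B C) = M_ABC A' B' C'"
proof -
  have i: "R ** matrix_inv R = mat 1" "matrix_inv (transpose R) ** transpose R = mat 1"
    using R by (simp_all add: GL_def matrix_inv_inverse transpose_invertible)
  have "R ** A ** matrix_inv R = A'"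
    unfolding assms(2) by (simp add: matrix_mul_assoc[symmetric] i)
  moreover have "matrix_inv (transpose R) ** C ** matrix_inv R =
      (matrix_inv (transpose R) ** transpose R) ** C' ** (R ** matrix_inv R)"
    by (simp only: assms(4)[symmetric] matrix_mul_assoc)
  ultimately show ?thesis
    by (simp add: GL_act_M_ABC assms(3) i)
qed

lemma GL_mult: "R \<in> GL \<Longrightarrow> T \<in> GL \<Longrightarrow> R ** T \<in> GL"
  by (simp add: GL_def invertible_mult)

lemma GL_matrix_inv: "R \<in> GL \<Longrightarrow> matrix_inv R \<in> GL"
  by (simp add: GL_def invertible_matrix_inv)

lemma GL_act_mult:
  assumes "R \<in> GL" "T \<in> GL"
  shows "GL_act (R ** T) M = GL_act R (GL_act T M)"
  using assms by (simp add: GL_act_def M_ABC_eq_iff GL_def matrix_transpose_mul matrix_inv_mult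
      transpose_invertible matrix_mul_assoc)

lemma GL_act_mat_1: "M \<in> SpI \<Longrightarrow> GL_act (mat 1) M = M"
  by (rule SpI_imp_M_ABC) (auto simp: GL_act_def matrix_inv_eqI[of "mat 1" "mat 1"])

lemma GL_act_SpI:
  assumes R: "R \<in> GL" and M: "M \<in> SpI"
  shows "GL_act R M \<in> SpI"
proof -
  obtain A B C where ABC: "M = M_ABC A B C" using M by (rule SpI_imp_M_ABC)
  have *: "transpose B = B" "transpose C = C" "A ** B = B ** transpose A"
     "transpose A ** C = C ** A" "A ** A - B ** C = mat 1"
    using M by (simp_all add: ABC SpI_iff)
  define R' where "R' = matrix_inv R"
  have inv: "R ** R' = mat 1" "R' ** R = mat 1"
    using R by (simp_all add: R'_def GL_def matrix_inv_inverse)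
  have inv_t: "transpose R ** transpose R' = mat 1" "transpose R' ** transpose R = mat 1"
    using inv by (simp_all add: matrix_transpose_mul[symmetric])
  \<comment> \<open>This and the following relations carry a trailing factor \<open>X\<close> so
    that they rewrite inside right-associated products.\<close>
  have canc: "R ** (R' ** X) = X" "R' ** (R ** X) = X"
    "transpose R ** (transpose R' ** X) = X" "transpose R' ** (transpose R ** X) = X" for X
    using inv inv_t by (simp_all add: matrix_mul_assoc)
  have r: "matrix_inv (transpose R) = transpose R'"
    using R by (simp add: R'_def GL_def matrix_inv_transpose)
  have BC: "B ** (C ** X) = A ** (A ** X) - X" for X
  proof -
    have "B ** C = A ** A - mat 1" using *(5) by (simp add: algebra_simps)
    then show ?thesis by (simp add: matrix_mul_assoc matrix_mult_distribs)
  qed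
  have AB: "A ** (B ** X) = B ** (transpose A ** X)"
    and CA: "transpose A ** (C ** X) = C ** (A ** X)" for X
    using *(3,4) by (simp_all add: matrix_mul_assoc)
  show ?thesis
    unfolding ABC GL_act_M_ABC SpI_iff r R'_def[symmetric]
    by (simp add: matrix_transpose_mul matrix_mul_assoc[symmetric] canc inv inv_t * AB CA BC
        matrix_mult_distribs)
qed

lemma orbit_GL_subset: "M \<in> SpI \<Longrightarrow> orbit GL GL_act M \<subseteq> SpI"
  by (auto simp: orbit_def GL_act_SpI)

lemma in_orbit_GL:
  assumes "M \<in> SpI"
  shows "M \<in> orbit GL GL_act M"
proof -
  have "mat 1 \<in> GL" unfolding GL_def invertible_def by (auto intro!: exI[of _ "mat 1"])
  then show ?thesis
    unfolding orbit_def using GL_act_mat_1[OF assms] by force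
qed

lemma orbit_GL_act:
  assumes "R \<in> GL" "M \<in> SpI"
  shows "orbit GL GL_act (GL_act R M) = orbit GL GL_act M"
proof -
  have "GL_act T (GL_act R M) \<in> orbit GL GL_act M" if "T \<in> GL" for T
    using that assms unfolding orbit_def by (metis GL_act_mult GL_mult imageI)
  moreover have "GL_act T M \<in> orbit GL GL_act (GL_act R M)" if "T \<in> GL" for T
  proof -
    have "(T ** matrix_inv R) ** R = T"
      using assms by (simp add: matrix_mul_assoc[symmetric] matrix_inv_inverse GL_def)
    then have "GL_act T M = GL_act (T ** matrix_inv R) (GL_act R M)"
      using that assms by (metis GL_act_mult GL_mult GL_matrix_inv)
    then show ?thesis
      using that assms unfolding orbit_def by (metis GL_matrix_inv GL_mult imageI)
  qed
  ultimately show ?thesis unfolding orbit_def by blast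
qed

lemma SpI_class_GL_act:
  "R \<in> GL \<Longrightarrow> M \<in> SpI \<Longrightarrow> SpI_class (GL_act R M) = SpI_class M"
  unfolding SpI_class_def by (intro git_class_cong_orbit) (simp_all add: orbit_GL_act GL_act_SpI)

text \<open>The one-sided form of the class relation. It is transitive by continuity of the action,
  so successive reductions and limits can be chained before passing to classes.\<close>

definition degenerates_to :: "'n::finite bmat \<Rightarrow> 'n bmat \<Rightarrow> bool" where
  "degenerates_to M N \<longleftrightarrow> M \<in> SpI \<and> N \<in> SpI \<and> N \<in> closure (orbit GL GL_act M)"

lemma degenerates_to_GL_act:
  "M \<in> SpI \<Longrightarrow> R \<in> GL \<Longrightarrow> degenerates_to M (GL_act R M)"
  unfolding degenerates_to_def using closure_subset[of "orbit GL GL_act M"]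
  by (auto simp: orbit_def GL_act_SpI)

text \<open>Each \<open>GL_act R\<close> is continuous and maps the orbit of \<open>L\<close> into
  itself, so it also preserves the closure; that closure therefore contains the orbit of
  \<open>M\<close> and its closure.\<close>

lemma degenerates_to_trans:
  assumes "degenerates_to L M" "degenerates_to M N"
  shows "degenerates_to L N"
proof -
  have "GL_act R M \<in> closure (orbit GL GL_act L)" if R: "R \<in> GL" for R
  proof (rule closure_map_in_closed[of M "orbit GL GL_act L" "GL_act R"])
    show "continuous_on UNIV (GL_act R)"
      unfolding GL_act_def by (intro continuous_intros)
    show "GL_act R u \<in> closure (orbit GL GL_act L)" if "u \<in> orbit GL GL_act L" for u
      using that R closure_subset[of "orbit GL GL_act L"] unfolding orbit_def
      by (force simp: GL_act_mult[symmetric] GL_mult)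
  qed (use assms in \<open>auto simp: degenerates_to_def\<close>)
  then have "closure (orbit GL GL_act M) \<subseteq> closure (orbit GL GL_act L)"
    unfolding orbit_def[of _ _ M] by (intro closure_minimal) auto
  then show ?thesis
    using assms unfolding degenerates_to_def by blast
qed

lemma degenerates_to_limit:
  assumes M: "M \<in> SpI" and N: "N \<in> SpI" and R: "\<And>k. R k \<in> GL"
    and lim: "(\<lambda>k. GL_act (R k) M) \<longlonglongrightarrow> N"
  shows "degenerates_to M N"
  unfolding degenerates_to_def closure_sequential
  using assms by (auto simp: orbit_def intro!: exI[of _ "\<lambda>k. GL_act (R k) M"])

lemma degenerates_to_SpI_class: "degenerates_to M N \<Longrightarrow> N \<in> SpI_class M"
  unfolding degenerates_to_def SpI_class_def
  by (auto intro!: closure_orbit_in_git_class in_orbit_GL dest: orbit_GL_subset)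

text \<open>A continuous invariant is constant on each orbit closure, points of a t1 space being
  closed, and the two values meet at the common limit point.\<close>

lemma SpI_class_invariant:
  fixes f :: "'n::finite bmat \<Rightarrow> 'b::t1_space"
  assumes "N \<in> SpI_class M" "continuous_on UNIV f"
    and inv: "\<And>R L. R \<in> GL \<Longrightarrow> L \<in> SpI \<Longrightarrow> f (GL_act R L) = f L"
  shows "f N = f M"
proof -
  obtain z where z: "M \<in> SpI" "N \<in> SpI"
    "z \<in> closure (orbit GL GL_act M)" "z \<in> closure (orbit GL GL_act N)"
    using assms(1) unfolding SpI_class_def by (rule git_classE)
  have "f z \<in> {f L}" if "z \<in> closure (orbit GL GL_act L)" "L \<in> SpI" for L
  proof (rule closure_map_in_closed[OF that(1) assms(2)])
    show "f u \<in> {f L}" if "u \<in> orbit GL GL_act L" for u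
      using that inv \<open>L \<in> SpI\<close> unfolding orbit_def by blast
  qed simp
  then have "f z = f M" "f z = f N" using z by blast+
  then show ?thesis by simp
qed

lemma SpI_class_trace_det:
  assumes "N \<in> SpI_class M"
  shows "trace (block_A N) = trace (block_A M)" "det (block_A N) = det (block_A M)"
proof -
  show "trace (block_A N) = trace (block_A M)"
    by (rule SpI_class_invariant[OF assms])
      (auto simp: GL_act_def GL_def trace_conjugate intro!: continuous_intros)
  show "det (block_A N) = det (block_A M)"
    by (rule SpI_class_invariant[OF assms])
      (auto simp: GL_act_def GL_def det_conjugate intro!: continuous_intros)
qed

section \<open>Coordinates, trace, determinant, and characteristic equation in dimension two\<close>

section \<open>Two by two matrices\<close>

lemma mat22_nth [simp]:
  "mat22 a b c d $ 1 $ 1 = a" "mat22 a b c d $ 1 $ 2 = b"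
  "mat22 a b c d $ 2 $ 1 = c" "mat22 a b c d $ 2 $ 2 = d"
  by (simp_all add: mat22_def)

lemma mat22_eq_iff: "mat22 a b c d = mat22 a' b' c' d' \<longleftrightarrow> a = a' \<and> b = b' \<and> c = c' \<and> d = d'"
  by (auto simp: vec_eq_iff forall_2)

lemma mat22_exhaust:
  obtains a b c d where "A = mat22 a b c d"
proof
  show "A = mat22 (A $ 1 $ 1) (A $ 1 $ 2) (A $ 2 $ 1) (A $ 2 $ 2)"
    by (simp add: vec_eq_iff forall_2)
qed

lemma mat22_mult:
  "mat22 a b c d ** mat22 a' b' c' d' =
     mat22 (a * a' + b * c') (a * b' + b * d') (c * a' + d * c') (c * b' + d * d')"
  by (simp add: vec_eq_iff forall_2 matrix_matrix_mult_def sum_2)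

lemma mat22_transpose: "transpose (mat22 a b c d) = mat22 a c b d"
  by (simp add: vec_eq_iff forall_2 transpose_def)

lemma mat22_symmetric_iff: "transpose (mat22 a b c d) = mat22 a b c d \<longleftrightarrow> c = b"
  unfolding mat22_transpose mat22_eq_iff by blast

lemma mat22_linear:
  "mat22 a b c d + mat22 a' b' c' d' = mat22 (a + a') (b + b') (c + c') (d + d')"
  "mat22 a b c d - mat22 a' b' c' d' = mat22 (a - a') (b - b') (c - c') (d - d')"
  "- mat22 a b c d = mat22 (- a) (- b) (- c) (- d)"
  "k *\<^sub>R mat22 a b c d = mat22 (k * a) (k * b) (k * c) (k * d)"
  by (simp_all add: vec_eq_iff forall_2)

lemma mat_1_mat22: "mat 1 = mat22 1 0 0 1"
  by (simp add: vec_eq_iff forall_2 mat_def)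

lemma zero_mat22: "0 = mat22 0 0 0 0"
  by (simp add: vec_eq_iff forall_2)

lemma trace_mat22: "trace (mat22 a b c d) = a + d"
  by (simp add: trace_def sum_2)

lemma det_mat22: "det (mat22 a b c d) = a * d - b * c"
  by (simp add: det_2)

lemma mat22_GL: "mat22 a b c d \<in> GL \<longleftrightarrow> a * d \<noteq> b * c"
  by (simp add: GL_def invertible_det_nz det_mat22)

lemmas mat22_simps = mat22_mult mat22_transpose mat22_linear mat_1_mat22 zero_mat22 mat22_eq_iff

lemma tendsto_mat22 [tendsto_intros]:
  assumes "(a \<longlongrightarrow> a') F" "(b \<longlongrightarrow> b') F" "(c \<longlongrightarrow> c') F" "(d \<longlongrightarrow> d') F"
  shows "((\<lambda>x. mat22 (a x) (b x) (c x) (d x)) \<longlongrightarrow> mat22 a' b' c' d') F"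
proof (intro vec_tendstoI)
  show "((\<lambda>x. mat22 (a x) (b x) (c x) (d x) $ i $ j) \<longlongrightarrow> mat22 a' b' c' d' $ i $ j) F" for i j
    using exhaust_2[of i] exhaust_2[of j] assms by auto
qed

lemma eigenvalues_mat22:
  "z \<in> eigenvalues (mat22 a b c d) \<longleftrightarrow> z\<^sup>2 - of_real (a + d) * z + of_real (a * d - b * c) = 0"
proof -
  let ?X = "map_matrix complex_of_real (mat22 a b c d) - mat z :: complex^2^2"
  have "z \<in> eigenvalues (mat22 a b c d) \<longleftrightarrow> (\<exists>v. v \<noteq> 0 \<and> ?X *v v = 0)"
  proof -
    have "mat z *v v = z *s v" for v :: "complex^2"
      by (simp add: vec_eq_iff forall_2 matrix_vector_mult_def sum_2 mat_def)
    then have "?X *v v = 0 \<longleftrightarrow> map_matrix complex_of_real (mat22 a b c d) *v v = z *s v" for v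
      by (simp add: matrix_vector_mult_diff_rdistrib)
    then show ?thesis by (simp add: eigenvalues_def)
  qed
  also have "\<dots> \<longleftrightarrow> det ?X = 0"
    by (metis invertible_det_nz invertible_left_inverse matrix_left_invertible_ker)
  also have "det ?X = z\<^sup>2 - of_real (a + d) * z + of_real (a * d - b * c)"
    by (simp add: det_2 mat_def map_matrix_def power2_eq_square algebra_simps)
  finally show ?thesis .
qed

text \<open>The set of eigenvalues forgets multiplicity. It is recovered because with z also t - z
  is a root, t being the trace, hence lies in {z, w}; this covers a double root as well.\<close>

lemma eigenvalues_pair_trace_det:
  fixes A :: "2 mat"
  assumes "eigenvalues A = {z, w}"
  shows "of_real (trace A) = z + w" "of_real (det A) = z * w"
proof -
  obtain a b c d where A: "A = mat22 a b c d" by (rule mat22_exhaust)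
  define t e :: complex where "t = of_real (a + d)" and "e = of_real (a * d - b * c)"
  have ev: "x \<in> {z, w} \<longleftrightarrow> x\<^sup>2 - t * x + e = 0" for x
    using eigenvalues_mat22[of x a b c d] assms by (simp add: A t_def e_def)
  have z: "z\<^sup>2 - t * z + e = 0" and w: "w\<^sup>2 - t * w + e = 0"
    using ev by auto
  have "(t - z)\<^sup>2 - t * (t - z) + e = 0"
    using z by (simp add: power2_eq_square algebra_simps)
  then have "t - z \<in> {z, w}" using ev by blast
  moreover have "z = w \<or> t = z + w"
  proof -
    have "(z - w) * (z + w - t) = 0"
    proof -
      have "(z - w) * (z + w - t) = (z\<^sup>2 - t * z + e) - (w\<^sup>2 - t * w + e)"
        by (simp add: power2_eq_square algebra_simps)
      then show ?thesis unfolding z w by simp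
    qed
    then show ?thesis by auto
  qed
  ultimately have t: "t = z + w" by auto
  moreover have "e = z * w"
    using z t by (simp add: power2_eq_square algebra_simps)
  ultimately show "of_real (trace A) = z + w" "of_real (det A) = z * w"
    by (simp_all add: A trace_mat22 det_mat22 t_def e_def)
qed

section \<open>Degeneration to diagonal or rotation-type normal forms\<close>

section \<open>Reduction to normal form\<close>

lemma sigma_s_square: "\<sigma>_of \<mu> * s_of \<mu> * s_of \<mu> = \<mu>\<^sup>2 - 1"
  by (simp add: \<sigma>_of_def s_of_def mult.assoc sgn_mult_abs)

lemma s_of_eq_0_iff: "s_of \<mu> = 0 \<longleftrightarrow> \<mu>\<^sup>2 = 1"
  by (simp add: s_of_def)

lemma s_of_nonneg: "0 \<le> s_of \<mu>"
  by (simp add: s_of_def)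

lemma N_real_SpI:
  assumes "\<epsilon>1 \<in> {1, -1}" "\<epsilon>2 \<in> {1, -1}"
  shows "N_real \<mu>1 \<epsilon>1 \<mu>2 \<epsilon>2 \<in> SpI"
  using assms sigma_s_square[of \<mu>1] sigma_s_square[of \<mu>2] unfolding N_real_def SpI_iff
  by (auto simp: mat22_simps power2_eq_square algebra_simps)

text \<open>The problem on one plane: scaling preserves bc and the sign of b. If \<mu>^2 \<noteq> 1,
  a constant \<rho> with \<rho>^2 |b| = \<open>s_of \<mu>\<close> works and \<epsilon> is the sign
  of b. If \<mu>^2 = 1, one of b, c vanishes and the other is scaled to zero, with \<rho> growing or
  shrinking accordingly; \<epsilon> = 1 is then arbitrary since \<open>s_of \<mu>\<close> =
  0.\<close>

lemma scaling_limit: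
  assumes bc: "b * c = \<mu>\<^sup>2 - 1"
  obtains \<epsilon> and \<rho> :: "nat \<Rightarrow> real" where "\<epsilon> \<in> {1, -1}" "\<And>k. 0 < \<rho> k"
    "(\<lambda>k. (\<rho> k)\<^sup>2 * b) \<longlonglongrightarrow> \<epsilon> * s_of \<mu>" "(\<lambda>k. c / (\<rho> k)\<^sup>2) \<longlonglongrightarrow> \<sigma>_of \<mu> * \<epsilon> * s_of \<mu>"
proof (cases "\<mu>\<^sup>2 = 1")
  case True
  then have s: "s_of \<mu> = 0" by (simp add: s_of_eq_0_iff)
  have lim: "(\<lambda>k. 1 / (real (Suc k))\<^sup>2 * x) \<longlonglongrightarrow> 0" for x
  proof -
    have "(\<lambda>k. (inverse (real (Suc k)))\<^sup>2 * x) \<longlonglongrightarrow> 0\<^sup>2 * x"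
      by (intro tendsto_intros LIMSEQ_inverse_real_of_nat)
    then show ?thesis by (simp add: inverse_eq_divide power_divide)
  qed
  show ?thesis
  proof (cases "b = 0")
    case True
    then show ?thesis
      using that[of 1 "\<lambda>k. real (Suc k)"] lim[of c] by (simp add: s)
  next
    case False
    then have "c = 0" using bc True by simp
    then show ?thesis
      using that[of 1 "\<lambda>k. 1 / real (Suc k)"] lim[of b] by (simp add: s power_divide)
  qed
next
  case False
  then have b: "b \<noteq> 0" and s: "0 < s_of \<mu>"
    using bc s_of_eq_0_iff[of \<mu>] s_of_nonneg[of \<mu>] by auto
  define \<rho> where "\<rho> = sqrt (s_of \<mu> / \<bar>b\<bar>)"
  have \<rho>: "0 < \<rho>" "\<rho>\<^sup>2 = s_of \<mu> / \<bar>b\<bar>" using b s by (simp_all add: \<rho>_def)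
  have 1: "\<rho>\<^sup>2 * b = sgn b * s_of \<mu>"
    using b by (simp add: \<rho>(2) sgn_if)
  have "c = \<sigma>_of \<mu> * s_of \<mu> * s_of \<mu> / b"
    unfolding sigma_s_square bc[symmetric] using b by simp
  then have 2: "c / \<rho>\<^sup>2 = \<sigma>_of \<mu> * sgn b * s_of \<mu>"
    using b s by (simp add: \<rho>(2) sgn_if field_simps)
  show ?thesis
    using that[of "sgn b" "\<lambda>_. \<rho>"] \<rho>(1) b 1 2 by (simp add: sgn_if)
qed

lemma diagonal_degenerates_to_N_real:
  assumes M: "M_ABC (mat22 \<mu>1 0 0 \<mu>2) (mat22 b1 0 0 b2) (mat22 c1 0 0 c2) \<in> SpI" (is "?M \<in> SpI")
  shows "\<exists>\<epsilon>1\<in>{1, -1}. \<exists>\<epsilon>2\<in>{1, -1}. degenerates_to ?M (N_real \<mu>1 \<epsilon>1 \<mu>2 \<epsilon>2)"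
proof -
  have "b1 * c1 = \<mu>1\<^sup>2 - 1" "b2 * c2 = \<mu>2\<^sup>2 - 1"
    using M by (simp_all add: SpI_iff mat22_simps power2_eq_square algebra_simps)
  obtain \<epsilon>1 \<rho>1 where 1: "\<epsilon>1 \<in> {1, -1}" "\<And>k. 0 < \<rho>1 k"
    "(\<lambda>k. (\<rho>1 k)\<^sup>2 * b1) \<longlonglongrightarrow> \<epsilon>1 * s_of \<mu>1" "(\<lambda>k. c1 / (\<rho>1 k)\<^sup>2) \<longlonglongrightarrow> \<sigma>_of \<mu>1 * \<epsilon>1 * s_of \<mu>1"
    using scaling_limit[OF \<open>b1 * c1 = \<mu>1\<^sup>2 - 1\<close>] by metis
  obtain \<epsilon>2 \<rho>2 where 2: "\<epsilon>2 \<in> {1, -1}" "\<And>k. 0 < \<rho>2 k"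
    "(\<lambda>k. (\<rho>2 k)\<^sup>2 * b2) \<longlonglongrightarrow> \<epsilon>2 * s_of \<mu>2" "(\<lambda>k. c2 / (\<rho>2 k)\<^sup>2) \<longlonglongrightarrow> \<sigma>_of \<mu>2 * \<epsilon>2 * s_of \<mu>2"
    using scaling_limit[OF \<open>b2 * c2 = \<mu>2\<^sup>2 - 1\<close>] by metis
  have pos: "\<rho>1 k \<noteq> 0" "\<rho>2 k \<noteq> 0" for k
    using 1(2)[of k] 2(2)[of k] by simp_all
  define R where "R k = mat22 (\<rho>1 k) 0 0 (\<rho>2 k)" for k
  have R: "R k \<in> GL" for k
    using pos[of k] by (simp add: R_def mat22_GL)
  have act: "GL_act (R k) ?M = M_ABC (mat22 \<mu>1 0 0 \<mu>2) (mat22 ((\<rho>1 k)\<^sup>2 * b1) 0 0 ((\<rho>2 k)\<^sup>2 * b2))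
      (mat22 (c1 / (\<rho>1 k)\<^sup>2) 0 0 (c2 / (\<rho>2 k)\<^sup>2))" for k
    using pos[of k] by (intro GL_act_eqI[OF R])
      (simp_all add: R_def mat22_simps power2_eq_square)
  have "degenerates_to ?M (N_real \<mu>1 \<epsilon>1 \<mu>2 \<epsilon>2)"
    by (rule degenerates_to_limit[where R = R, OF M N_real_SpI R], rule 1(1), rule 2(1))
      (unfold act N_real_def, intro tendsto_M_ABC tendsto_mat22 tendsto_const 1(3,4) 2(3,4))
  then show ?thesis using 1(1) 2(1) by blast
qed

text \<open>The traceless part of a symmetric matrix with rows (p, q), (q, r) is the complex number
  (p - r)/2 + iq, and rotation by an angle turns it by twice that angle. Rotating by minus half its
  argument makes it real.\<close>

lemma rotation_diagonalizes:
  fixes p q r :: real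
  obtains x y where "x\<^sup>2 + y\<^sup>2 = 1" "x * y * (p - r) + (x\<^sup>2 - y\<^sup>2) * q = 0"
proof -
  obtain \<rho> \<psi> where "Complex ((p - r) / 2) q = rcis \<rho> \<psi>"
    using rcis_Ex by blast
  then have pq: "p - r = 2 * \<rho> * cos \<psi>" "q = \<rho> * sin \<psi>"
    by (simp_all add: complex_eq_iff)
  have half: "cos \<psi> = (cos (\<psi> / 2))\<^sup>2 - (sin (\<psi> / 2))\<^sup>2" "sin \<psi> = 2 * sin (\<psi> / 2) * cos (\<psi> / 2)"
    using cos_double[of "\<psi> / 2"] sin_double[of "\<psi> / 2"] by simp_all
  have "cos (\<psi> / 2) * (- sin (\<psi> / 2)) * (p - r)
      + ((cos (\<psi> / 2))\<^sup>2 - (- sin (\<psi> / 2))\<^sup>2) * q = 0"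
    unfolding pq half by (simp add: algebra_simps)
  then show ?thesis
    by (intro that[of "cos (\<psi> / 2)" "- sin (\<psi> / 2)"]) simp_all
qed

lemma rotation_act:
  assumes "x\<^sup>2 + y\<^sup>2 = 1"
  shows "mat22 x (- y) y x \<in> GL"
    "GL_act (mat22 x (- y) y x) (M_ABC (mat22 \<mu> 0 0 \<mu>) B C) = M_ABC (mat22 \<mu> 0 0 \<mu>)
      (mat22 x (- y) y x ** B ** mat22 x y (- y) x) (mat22 x (- y) y x ** C ** mat22 x y (- y) x)"
proof -
  have xy: "x * x + y * y = 1" using assms by (simp add: power2_eq_square)
  show R: "mat22 x (- y) y x \<in> GL"
  proof -
    have "x * x \<noteq> (- y) * y" using xy by auto
    then show ?thesis by (simp add: mat22_GL)
  qed
  have inv: "mat22 x y (- y) x ** mat22 x (- y) y x = mat 1"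
    using xy by (simp add: mat22_simps add.commute mult.commute)
  have "mat22 x y (- y) x ** (mat22 x (- y) y x ** C ** mat22 x y (- y) x) ** mat22 x (- y) y x
    = (mat22 x y (- y) x ** mat22 x (- y) y x) ** C ** (mat22 x y (- y) x ** mat22 x (- y) y x)"
    by (simp only: matrix_mul_assoc)
  also have "\<dots> = C" by (simp add: inv)
  finally show "GL_act (mat22 x (- y) y x) (M_ABC (mat22 \<mu> 0 0 \<mu>) B C) = M_ABC (mat22 \<mu> 0 0 \<mu>)
      (mat22 x (- y) y x ** B ** mat22 x y (- y) x) (mat22 x (- y) y x ** C ** mat22 x y (- y) x)"
    by (intro GL_act_eqI[OF R]) (simp_all add: mat22_transpose mat22_mult mult.commute)
qed

lemma rotation_congruence:
  assumes "x * y * (p - r) + (x\<^sup>2 - y\<^sup>2) * q = 0"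
  obtains d1 d2 where
    "mat22 x (- y) y x ** mat22 p q q r ** mat22 x y (- y) x = mat22 d1 0 0 d2"
proof -
  have "x * (y * p) - y * (y * q) + (x * (x * q) - x * (y * r)) = 0"
    using assms by (simp add: power2_eq_square algebra_simps)
  then have "mat22 x (- y) y x ** mat22 p q q r ** mat22 x y (- y) x =
      mat22 (x * x * p - 2 * x * y * q + y * y * r) 0 0 (y * y * p + 2 * x * y * q + x * x * r)"
    by (simp add: mat22_mult mat22_eq_iff algebra_simps)
  then show ?thesis using that by blast
qed

lemma degenerates_to_N_real_trans:
  assumes "degenerates_to L M"
    and "\<exists>\<epsilon>1\<in>{1, -1}. \<exists>\<epsilon>2\<in>{1, -1}. degenerates_to M (N_real \<mu>1 \<epsilon>1 \<mu>2 \<epsilon>2)"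
  shows "\<exists>\<epsilon>1\<in>{1, -1}. \<exists>\<epsilon>2\<in>{1, -1}. degenerates_to L (N_real \<mu>1 \<epsilon>1 \<mu>2 \<epsilon>2)"
  using assms(2) degenerates_to_trans[OF assms(1)] by blast

text \<open>Rotations fix a scalar A and conjugate both B and C. After B is made diagonal, A^2 - BC
  = I gives b1 c12 = b2 c12 = 0: either C is diagonal too, or B = 0 and a second rotation is free to
  diagonalize C.\<close>

lemma scalar_degenerates_to_N_real:
  assumes M: "M_ABC (mat22 \<mu> 0 0 \<mu>) B C \<in> SpI" (is "?M \<in> SpI")
  shows "\<exists>\<epsilon>1\<in>{1, -1}. \<exists>\<epsilon>2\<in>{1, -1}. degenerates_to ?M (N_real \<mu> \<epsilon>1 \<mu> \<epsilon>2)"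
proof -
  obtain p q q' r where pqr: "B = mat22 p q q' r" by (rule mat22_exhaust)
  have "transpose B = B" using M unfolding SpI_iff by blast
  then have B: "B = mat22 p q q r" by (simp add: pqr mat22_symmetric_iff)
  obtain x y where xy: "x\<^sup>2 + y\<^sup>2 = 1" "x * y * (p - r) + (x\<^sup>2 - y\<^sup>2) * q = 0"
    by (rule rotation_diagonalizes)
  obtain b1 b2 where "mat22 x (- y) y x ** B ** mat22 x y (- y) x = mat22 b1 0 0 b2"
    unfolding B using rotation_congruence[OF xy(2)] .
  then have "GL_act (mat22 x (- y) y x) ?M = M_ABC (mat22 \<mu> 0 0 \<mu>) (mat22 b1 0 0 b2)
      (mat22 x (- y) y x ** C ** mat22 x y (- y) x)"
    unfolding rotation_act(2)[OF xy(1)] by simp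
  then obtain C' where deg: "degenerates_to ?M (M_ABC (mat22 \<mu> 0 0 \<mu>) (mat22 b1 0 0 b2) C')"
      (is "degenerates_to ?M ?M'")
    using degenerates_to_GL_act[OF M rotation_act(1)[OF xy(1)]] by metis
  then have M': "?M' \<in> SpI" by (simp add: degenerates_to_def)
  obtain c1 c12 c21 c2 where c: "C' = mat22 c1 c12 c21 c2" by (rule mat22_exhaust)
  have eqs: "transpose C' = C'"
    "mat22 \<mu> 0 0 \<mu> ** mat22 \<mu> 0 0 \<mu> - mat22 b1 0 0 b2 ** C' = mat 1"
    using M' unfolding SpI_iff by blast+
  have C': "C' = mat22 c1 c12 c12 c2"
    using eqs(1) by (simp add: c mat22_symmetric_iff)
  have bc: "b1 * c12 = 0" "b2 * c12 = 0"
    using eqs(2) unfolding C' by (simp_all add: mat22_simps)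
  show ?thesis
  proof (rule degenerates_to_N_real_trans[OF deg], cases "c12 = 0")
    case True
    then show "\<exists>\<epsilon>1\<in>{1, -1}. \<exists>\<epsilon>2\<in>{1, -1}. degenerates_to ?M' (N_real \<mu> \<epsilon>1 \<mu> \<epsilon>2)"
      using M' unfolding C' True by (intro diagonal_degenerates_to_N_real)
  next
    case False
    then have b: "b1 = 0" "b2 = 0" using bc by auto
    obtain x y where xy: "x\<^sup>2 + y\<^sup>2 = 1" "x * y * (c1 - c2) + (x\<^sup>2 - y\<^sup>2) * c12 = 0"
      by (rule rotation_diagonalizes)
    obtain d1 d2 where "mat22 x (- y) y x ** C' ** mat22 x y (- y) x = mat22 d1 0 0 d2"
      unfolding C' using rotation_congruence[OF xy(2)] .
    then have act: "GL_act (mat22 x (- y) y x) ?M'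
        = M_ABC (mat22 \<mu> 0 0 \<mu>) (mat22 0 0 0 0) (mat22 d1 0 0 d2)"
      using rotation_act(2)[OF xy(1), of \<mu> "mat22 b1 0 0 b2" C'] b by (simp add: mat22_mult)
    have deg': "degenerates_to ?M' (M_ABC (mat22 \<mu> 0 0 \<mu>) (mat22 0 0 0 0) (mat22 d1 0 0 d2))"
      using degenerates_to_GL_act[OF M' rotation_act(1)[OF xy(1)]] unfolding act .
    then show "\<exists>\<epsilon>1\<in>{1, -1}. \<exists>\<epsilon>2\<in>{1, -1}. degenerates_to ?M' (N_real \<mu> \<epsilon>1 \<mu> \<epsilon>2)"
      by (intro degenerates_to_N_real_trans[OF deg'] diagonal_degenerates_to_N_real)
        (simp add: degenerates_to_def)
  qed
qed

text \<open>A left eigenvector (r, s) for \<mu>2 becomes the second row of R. The orthogonal first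
  row (s, -r) makes det R = r^2 + s^2 nonzero, and the trace forces \<mu>1 as the other diagonal
  entry.\<close>

lemma triangularizable:
  assumes "a + d = \<mu>1 + \<mu>2" "a * d - b * c = \<mu>1 * \<mu>2"
  obtains R t where "R \<in> GL" "R ** mat22 a b c d = mat22 \<mu>1 t 0 \<mu>2 ** R"
proof -
  have \<mu>1: "\<mu>1 = a + d - \<mu>2" using assms(1) by simp
  have char: "b * c = (a - \<mu>2) * (d - \<mu>2)"
    using assms(2) unfolding \<mu>1 by (simp add: algebra_simps)
  obtain r s where rs: "r \<noteq> 0 \<or> s \<noteq> 0" "r * a + s * c = \<mu>2 * r" "r * b + s * d = \<mu>2 * s"
  proof -
    \<comment> \<open>The vector (c, \<mu>2 - a) solves the first eigenvector equation; the other
      cases are those where it vanishes, the last being a scalar matrix.\<close>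
    consider "c \<noteq> 0 \<or> \<mu>2 \<noteq> a" | "c = 0" "\<mu>2 = a" "a \<noteq> d \<or> b \<noteq> 0" | "c = 0" "\<mu>2 = a" "a = d" "b = 0"
      by auto
    then show ?thesis
    proof cases
      case 1
      then show ?thesis
        using char by (intro that[of c "\<mu>2 - a"]) (auto simp: algebra_simps)
    next
      case 2
      then show ?thesis by (intro that[of "a - d" b]) (auto simp: algebra_simps)
    next
      case 3
      then show ?thesis by (intro that[of 1 0]) auto
    qed
  qed
  define n where "n = r\<^sup>2 + s\<^sup>2"
  have n: "n \<noteq> 0" using rs(1) by (simp add: n_def sum_power2_eq_zero_iff)
  \<comment> \<open>The row (u, v) is (s, -r)A; its components along (s, -r) and (r, s) are \<mu>1
    and t.\<close>
  define u v where "u = s * a - r * c" and "v = s * b - r * d"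
  define t where "t = (u * r + v * s) / n"
  have tn: "t * n = u * r + v * s" using n by (simp add: t_def)
  have "u * s - v * r = s * s * a + r * r * d - r * (s * c) - s * (r * b)"
    by (simp add: u_def v_def algebra_simps)
  also have "s * c = \<mu>2 * r - r * a" using rs(2) by simp
  also have "r * b = \<mu>2 * s - s * d" using rs(3) by simp
  finally have uv: "u * s - v * r = \<mu>1 * n"
    by (simp add: \<mu>1 n_def power2_eq_square algebra_simps)
  have "n * u = s * (u * s - v * r) + r * (u * r + v * s)"
    "n * v = - r * (u * s - v * r) + s * (u * r + v * s)"
    by (simp_all add: n_def power2_eq_square algebra_simps)
  then have "n * u = n * (\<mu>1 * s + t * r)" "n * v = n * (- \<mu>1 * r + t * s)"
    unfolding uv tn[symmetric] by (simp_all add: algebra_simps)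
  then have "u = \<mu>1 * s + t * r" "v = - \<mu>1 * r + t * s" using n by simp_all
  then have "mat22 s (- r) r s ** mat22 a b c d = mat22 \<mu>1 t 0 \<mu>2 ** mat22 s (- r) r s"
    using rs(2,3) by (simp add: mat22_simps u_def v_def)
  moreover have "mat22 s (- r) r s \<in> GL"
  proof -
    have "s * s - (- r) * r \<noteq> 0" using n by (simp add: n_def power2_eq_square add.commute)
    then show ?thesis unfolding mat22_GL by linarith
  qed
  ultimately show ?thesis using that by blast
qed

lemma GL_act_A:
  assumes "R \<in> GL" "R ** A = A' ** R"
  obtains B' C' where "GL_act R (M_ABC A B C) = M_ABC A' B' C'"
proof -
  have "R ** A ** matrix_inv R = A'"
    unfolding assms(2) using assms(1) by (simp add: matrix_mul_assoc[symmetric] matrix_inv_inverse GL_def)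
  then show ?thesis using that by (simp add: GL_act_M_ABC)
qed

lemma real_degenerates_to_N_real:
  assumes M: "M_ABC A B C \<in> SpI" and tr: "trace A = \<mu>1 + \<mu>2" and det: "det A = \<mu>1 * \<mu>2"
  shows "\<exists>\<epsilon>1\<in>{1, -1}. \<exists>\<epsilon>2\<in>{1, -1}. degenerates_to (M_ABC A B C) (N_real \<mu>1 \<epsilon>1 \<mu>2 \<epsilon>2)"
proof -
  obtain a b c d where A: "A = mat22 a b c d" by (rule mat22_exhaust)
  obtain R t where R: "R \<in> GL" "R ** A = mat22 \<mu>1 t 0 \<mu>2 ** R"
    using triangularizable[of a d \<mu>1 \<mu>2 b c] tr det unfolding A trace_mat22 det_mat22 by blast
  show ?thesis
  proof (cases "\<mu>1 = \<mu>2")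
    case False
    define S where "S = mat22 1 (t / (\<mu>1 - \<mu>2)) 0 1"
    have S: "S \<in> GL" by (simp add: S_def mat22_GL)
    have "S ** mat22 \<mu>1 t 0 \<mu>2 = mat22 \<mu>1 0 0 \<mu>2 ** S"
      using False by (simp add: S_def mat22_simps field_simps)
    then have "(S ** R) ** A = mat22 \<mu>1 0 0 \<mu>2 ** (S ** R)"
      by (metis R(2) matrix_mul_assoc)
    then obtain B' C' where act: "GL_act (S ** R) (M_ABC A B C) = M_ABC (mat22 \<mu>1 0 0 \<mu>2) B' C'"
      using GL_act_A[OF GL_mult[OF S R(1)]] by blast
    have deg: "degenerates_to (M_ABC A B C) (M_ABC (mat22 \<mu>1 0 0 \<mu>2) B' C')"
      using degenerates_to_GL_act[OF M GL_mult[OF S R(1)]] act by simp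
    obtain b1 b12 b21 b2 where B': "B' = mat22 b1 b12 b21 b2" by (rule mat22_exhaust)
    obtain c1 c12 c21 c2 where C': "C' = mat22 c1 c12 c21 c2" by (rule mat22_exhaust)
    have eqs: "transpose B' = B'" "transpose C' = C'" "mat22 \<mu>1 0 0 \<mu>2 ** B' = B' ** transpose (mat22 \<mu>1 0 0 \<mu>2)"
      "transpose (mat22 \<mu>1 0 0 \<mu>2) ** C' = C' ** mat22 \<mu>1 0 0 \<mu>2"
      using deg unfolding degenerates_to_def SpI_iff by blast+
    have "b21 = b12" "c21 = c12"
      using eqs(1,2) by (simp_all add: B' C' mat22_symmetric_iff)
    moreover have "b12 = 0" "c12 = 0"
      using eqs(3,4) False unfolding B' C' mat22_transpose mat22_mult mat22_eq_iff by auto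
    ultimately have "B' = mat22 b1 0 0 b2" "C' = mat22 c1 0 0 c2" by (simp_all add: B' C')
    then have "M_ABC (mat22 \<mu>1 0 0 \<mu>2) (mat22 b1 0 0 b2) (mat22 c1 0 0 c2) \<in> SpI"
      and deg': "degenerates_to (M_ABC A B C)
        (M_ABC (mat22 \<mu>1 0 0 \<mu>2) (mat22 b1 0 0 b2) (mat22 c1 0 0 c2))"
      using deg by (simp_all add: degenerates_to_def)
    then show ?thesis
      by (intro degenerates_to_N_real_trans[OF deg'] diagonal_degenerates_to_N_real)
  next
    case True
    define \<mu> where "\<mu> = \<mu>1"
    have \<mu>: "\<mu>1 = \<mu>" "\<mu>2 = \<mu>" using True by (simp_all add: \<mu>_def)
    obtain B' C' where act: "GL_act R (M_ABC A B C) = M_ABC (mat22 \<mu> t 0 \<mu>) B' C'"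
      using GL_act_A[OF R] unfolding \<mu> by blast
    have deg: "degenerates_to (M_ABC A B C) (M_ABC (mat22 \<mu> t 0 \<mu>) B' C')"
      using degenerates_to_GL_act[OF M R(1)] act by simp
    then have M': "M_ABC (mat22 \<mu> t 0 \<mu>) B' C' \<in> SpI" by (simp add: degenerates_to_def)
    show ?thesis
    proof (cases "t = 0")
      case True
      show ?thesis
        using M' deg unfolding \<mu> True
        by (intro degenerates_to_N_real_trans[OF deg[unfolded True]] scalar_degenerates_to_N_real)
    next
      case False
      obtain p q q' r where B': "B' = mat22 p q q' r" by (rule mat22_exhaust)
      obtain w x x' y where C': "C' = mat22 w x x' y" by (rule mat22_exhaust)
      have eqs: "transpose B' = B'" "transpose C' = C'"
        "mat22 \<mu> t 0 \<mu> ** B' = B' ** transpose (mat22 \<mu> t 0 \<mu>)"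
        "transpose (mat22 \<mu> t 0 \<mu>) ** C' = C' ** mat22 \<mu> t 0 \<mu>"
        "mat22 \<mu> t 0 \<mu> ** mat22 \<mu> t 0 \<mu> - B' ** C' = mat 1"
        using M' unfolding SpI_iff by blast+
      have 1: "q' = q" "x' = x"
        using eqs(1,2) by (simp_all add: B' C' mat22_symmetric_iff)
      \<comment> \<open>For a nontrivial Jordan block, symmetry of AB and of A^T C forces these two
        corners to vanish. They are the entries that the scaling \<open>T\<close> below would blow
        up.\<close>
      have "r = 0" "w = 0"
        using eqs(3,4) False
        unfolding B' C' 1 mat22_transpose mat22_mult mat22_eq_iff by auto
      moreover from this have "\<mu> * \<mu> - q * x = 1"
        using eqs(5) unfolding B' C' 1 by (simp add: mat22_simps)
      ultimately have *: "q' = q" "r = 0" "x' = x" "w = 0" "\<mu> * \<mu> - q * x = 1"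
        using 1 by blast+
      have M0: "M_ABC (mat22 \<mu> 0 0 \<mu>) (mat22 0 q q 0) (mat22 0 x x 0) \<in> SpI"
        using *(5) by (simp add: SpI_iff mat22_simps)
      \<comment> \<open>This scaling multiplies t, p and y by \<open>\<tau> k\<close> and fixes q
        and x, so its limit has scalar A and the scalar case applies.\<close>
      define T where "T k = mat22 (1 / real (Suc k)) 0 0 (real (Suc k))" for k
      have T: "T k \<in> GL" for k by (simp add: T_def mat22_GL)
      define \<tau> where "\<tau> k = (1 / real (Suc k))\<^sup>2" for k
      have \<tau>: "\<tau> \<longlonglongrightarrow> 0"
      proof -
        have "(\<lambda>k. (inverse (real (Suc k)))\<^sup>2) \<longlonglongrightarrow> 0\<^sup>2"
          by (intro tendsto_intros LIMSEQ_inverse_real_of_nat)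
        then show ?thesis unfolding \<tau>_def by (simp add: inverse_eq_divide)
      qed
      have actT: "GL_act (T k) (M_ABC (mat22 \<mu> t 0 \<mu>) B' C') = M_ABC (mat22 \<mu> (\<tau> k * t) 0 \<mu>)
          (mat22 (\<tau> k * p) q q 0) (mat22 0 x x (\<tau> k * y))" for k
        by (rule GL_act_eqI[OF T])
          (simp_all add: T_def \<tau>_def B' C' * mat22_simps power2_eq_square del: of_nat_Suc)
      have "(\<lambda>k. GL_act (T k) (M_ABC (mat22 \<mu> t 0 \<mu>) B' C')) \<longlonglongrightarrow>
          M_ABC (mat22 \<mu> (0 * t) 0 \<mu>) (mat22 (0 * p) q q 0) (mat22 0 x x (0 * y))"
        unfolding actT by (intro tendsto_intros \<tau>)
      then have "degenerates_to (M_ABC (mat22 \<mu> t 0 \<mu>) B' C')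
          (M_ABC (mat22 \<mu> 0 0 \<mu>) (mat22 0 q q 0) (mat22 0 x x 0))"
        by (intro degenerates_to_limit[OF M' M0 T]) simp
      then have "degenerates_to (M_ABC A B C) (M_ABC (mat22 \<mu> 0 0 \<mu>) (mat22 0 q q 0) (mat22 0 x x 0))"
        using degenerates_to_trans[OF deg] by blast
      then show ?thesis
        unfolding \<mu> by (rule degenerates_to_N_real_trans) (rule scalar_degenerates_to_N_real[OF M0])
    qed
  qed
qed

lemma complex_degenerates_to_N_complex:
  assumes M: "M_ABC A B C \<in> SpI" and r: "0 < r" and \<theta>: "0 < \<theta>" "\<theta> < pi"
    and tr: "trace A = 2 * r * cos \<theta>" and det: "det A = r\<^sup>2"
  shows "degenerates_to (M_ABC A B C) (N_complex r \<theta>)"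
proof -
  define \<alpha> \<beta> where "\<alpha> = r * cos \<theta>" and "\<beta> = r * sin \<theta>"
  have \<beta>: "0 < \<beta>" using r \<theta> sin_gt_zero by (simp add: \<beta>_def)
  have "\<alpha>\<^sup>2 + \<beta>\<^sup>2 = r\<^sup>2 * ((cos \<theta>)\<^sup>2 + (sin \<theta>)\<^sup>2)"
    by (simp add: \<alpha>_def \<beta>_def power_mult_distrib distrib_left del: sin_cos_squared_add2)
  then have \<alpha>\<beta>: "\<alpha>\<^sup>2 + \<beta>\<^sup>2 = r\<^sup>2" by simp
  obtain a b c d where A: "A = mat22 a b c d" by (rule mat22_exhaust)
  have d: "d = 2 * \<alpha> - a" using tr by (simp add: A trace_mat22 \<alpha>_def)
  have bc: "b * c = - (\<alpha> - a)\<^sup>2 - \<beta>\<^sup>2"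
    using det \<alpha>\<beta> by (simp add: A det_mat22 d power2_eq_square algebra_simps)
  have b: "b \<noteq> 0"
  proof
    assume "b = 0"
    then have "(\<alpha> - a)\<^sup>2 + \<beta>\<^sup>2 = 0" using bc by (simp del: sum_power2_eq_zero_iff)
    then show False using \<beta> by (simp add: sum_power2_eq_zero_iff)
  qed
  \<comment> \<open>The first row is e1; the second is then forced by e1 A = \<alpha> e1 - \<beta>
    (second row). It is independent of e1 because b \<noteq> 0.\<close>
  define R where "R = mat22 1 0 ((\<alpha> - a) / \<beta>) (- b / \<beta>)"
  have R: "R \<in> GL" using b \<beta> by (simp add: R_def mat22_GL)
  have "R ** A = mat22 \<alpha> (- \<beta>) \<beta> \<alpha> ** R"
  proof -
    have "(\<alpha> - a) * a - b * c = \<beta> * \<beta> + \<alpha> * (\<alpha> - a)"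
      unfolding bc by (simp add: power2_eq_square algebra_simps)
    then have "((\<alpha> - a) * a - b * c) / \<beta> = (\<beta> * \<beta> + \<alpha> * (\<alpha> - a)) / \<beta>" by simp
    then have "(\<alpha> - a) / \<beta> * a + - b / \<beta> * c = \<beta> + \<alpha> * ((\<alpha> - a) / \<beta>)"
      using \<beta> by (simp add: diff_divide_distrib[of "(\<alpha> - a) * a"] add_divide_distrib)
    moreover have "(\<alpha> - a) / \<beta> * b + - b / \<beta> * d = \<alpha> * (- b / \<beta>)"
      using \<beta> by (simp add: d field_simps)
    ultimately show ?thesis
      using \<beta> by (simp add: R_def A mat22_simps)
  qed
  then obtain B' C' where act: "GL_act R (M_ABC A B C) = M_ABC (mat22 \<alpha> (- \<beta>) \<beta> \<alpha>) B' C'"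
    using GL_act_A[OF R] by blast
  have deg: "degenerates_to (M_ABC A B C) (M_ABC (mat22 \<alpha> (- \<beta>) \<beta> \<alpha>) B' C')" (is "degenerates_to _ ?M'")
    using degenerates_to_GL_act[OF M R] act by simp
  then have M': "?M' \<in> SpI" by (simp add: degenerates_to_def)
  obtain p q q' s where B': "B' = mat22 p q q' s" by (rule mat22_exhaust)
  have q: "q' = q" "s = - p"
  proof -
    have eqs: "transpose B' = B'"
      "mat22 \<alpha> (- \<beta>) \<beta> \<alpha> ** B' = B' ** transpose (mat22 \<alpha> (- \<beta>) \<beta> \<alpha>)"
      using M' unfolding SpI_iff by blast+
    show q: "q' = q" using eqs(1) by (simp add: B' mat22_symmetric_iff)
    have "\<beta> * (p + s) = 0"
      using eqs(2) unfolding B' q by (simp add: mat22_simps algebra_simps)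
    then show "s = - p" using \<beta> by simp
  qed
  \<comment> \<open>If B vanished, then A^2 = I, which is impossible for a matrix with nonreal
    eigenvalues.\<close>
  have "p \<noteq> 0 \<or> q \<noteq> 0"
  proof (rule ccontr)
    assume "\<not> (p \<noteq> 0 \<or> q \<noteq> 0)"
    then have "B' = 0" by (simp add: B' q zero_mat22)
    moreover have "mat22 \<alpha> (- \<beta>) \<beta> \<alpha> ** mat22 \<alpha> (- \<beta>) \<beta> \<alpha> - B' ** C' = mat 1"
      using M' unfolding SpI_iff by blast
    ultimately have "mat22 \<alpha> (- \<beta>) \<beta> \<alpha> ** mat22 \<alpha> (- \<beta>) \<beta> \<alpha> = mat 1"
      by (simp add: matrix_mult.zero_left)
    then have "\<alpha> * \<alpha> - \<beta> * \<beta> = 1" "\<alpha> * \<beta> = 0"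
      by (simp_all add: mat22_simps)
    then have "\<beta> * \<beta> = - 1" using \<beta> by simp
    then show False by (metis not_one_le_zero not_square_less_zero neg_less_0_iff_less zero_less_one)
  qed
  \<comment> \<open>With the plane read as the complex numbers, B is z \<mapsto> (p + iq) cnj z, and
    multiplication by \<zeta> replaces p + iq by \<zeta>^2 (p + iq) while commuting with A. A
    complex square root thus normalizes B, and no sign remains.\<close>
  then have w: "Complex p q \<noteq> 0" by (auto simp: complex_eq_iff)
  define \<zeta> where "\<zeta> = csqrt (1 / Complex p q)"
  have \<zeta>: "\<zeta>\<^sup>2 * Complex p q = 1" using w by (simp add: \<zeta>_def)
  define u v where "u = Re \<zeta>" and "v = Im \<zeta>"
  have "Re (\<zeta>\<^sup>2 * Complex p q) = 1" "Im (\<zeta>\<^sup>2 * Complex p q) = 0"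
    unfolding \<zeta> by simp_all
  then have uv: "(u * u - v * v) * p - (2 * u * v) * q = 1" "(u * u - v * v) * q + 2 * u * v * p = 0"
    by (simp_all add: u_def v_def power2_eq_square algebra_simps)
  define S where "S = mat22 u (- v) v u"
  have S: "S \<in> GL"
  proof -
    have "u * u + v * v \<noteq> 0"
      using uv(1) by (auto simp: sum_squares_eq_zero_iff)
    then have "u * u \<noteq> (- v) * v" by linarith
    then show ?thesis by (simp add: S_def mat22_GL)
  qed
  have "S ** mat22 \<alpha> (- \<beta>) \<beta> \<alpha> = mat22 \<alpha> (- \<beta>) \<beta> \<alpha> ** S"
    by (simp add: S_def mat22_simps algebra_simps)
  then obtain C'' where act': "GL_act S ?M' = M_ABC (mat22 \<alpha> (- \<beta>) \<beta> \<alpha>) (S ** B' ** transpose S) C''"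
    using GL_act_A[OF S, of _ _ B' C'] by (metis GL_act_M_ABC M_ABC_eq_iff)
  have SB: "S ** B' ** transpose S = mat22 1 0 0 (- 1)"
    using uv by (simp add: S_def B' q mat22_simps algebra_simps)
  have deg': "degenerates_to ?M' (M_ABC (mat22 \<alpha> (- \<beta>) \<beta> \<alpha>) (mat22 1 0 0 (- 1)) C'')"
    using degenerates_to_GL_act[OF M' S] act' SB by simp
  \<comment> \<open>Since the normalized B is its own inverse, A^2 - BC = I determines C.\<close>
  then have "mat22 \<alpha> (- \<beta>) \<beta> \<alpha> ** mat22 \<alpha> (- \<beta>) \<beta> \<alpha> - mat22 1 0 0 (- 1) ** C'' = mat 1"
    by (simp add: degenerates_to_def SpI_iff)
  then have "mat22 \<alpha> (- \<beta>) \<beta> \<alpha> ** mat22 \<alpha> (- \<beta>) \<beta> \<alpha> - mat 1 = mat22 1 0 0 (- 1) ** C''"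
    by (simp add: algebra_simps)
  moreover have "mat22 1 0 0 (- 1) ** (mat22 1 0 0 (- 1) ** C'') = C''"
    by (simp add: matrix_mul_assoc mat22_mult flip: mat_1_mat22)
  ultimately have "C'' = mat22 1 0 0 (- 1) ** (mat22 \<alpha> (- \<beta>) \<beta> \<alpha> ** mat22 \<alpha> (- \<beta>) \<beta> \<alpha> - mat 1)"
    by simp
  then have "N_complex r \<theta> = M_ABC (mat22 \<alpha> (- \<beta>) \<beta> \<alpha>) (mat22 1 0 0 (- 1)) C''"
    by (simp add: N_complex_def Let_def \<alpha>_def \<beta>_def)
  then show ?thesis using deg deg' degenerates_to_trans by metis
qed

section \<open>Separating signs by limits of (A - \<nu>)B and of B\<close>

section \<open>Sign obstructions for the general linear action\<close>

lemma qform_minus: "qform (- X) x = - qform X x"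
  by (simp add: qform_def matrix_vector_mult.minus_left)

text \<open>The form \<open>(A - \<nu>)B\<close> transforms by congruence, so semidefiniteness survives in orbit closures.
  A common limit of two orbits with opposite signs therefore has \<open>(A - \<nu>)B = 0\<close>, and then
  \<open>A\<^sup>2 - BC = I\<close> forces \<open>A = \<nu>\<close>.\<close>

lemma SpI_sign_obstruction:
  fixes M M' :: "'n::finite bmat" and \<nu> :: real
  defines "P \<equiv> \<lambda>L. block_A L - \<nu> *\<^sub>R mat 1"
  assumes z: "z \<in> SpI" "z \<in> closure (orbit GL GL_act M)" "z \<in> closure (orbit GL GL_act M')"
    and rel: "P M ** block_A M = \<mu> *\<^sub>R P M" and \<mu>: "\<mu>\<^sup>2 \<noteq> 1"
    and M: "\<And>x. 0 \<le> \<delta> * qform (P M ** block_B M) x"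
    and M': "\<And>x. \<delta> * qform (P M' ** block_B M') x \<le> 0" and \<delta>: "\<delta> \<noteq> 0"
  shows "trace (block_A M) = \<nu> * real CARD('n)"
proof -
  have P: "P (GL_act R L) = R ** P L ** matrix_inv R" if "R \<in> GL" for R L
    using that by (simp add: P_def GL_act_def matrix_mult_distribs matrix_inv_inverse GL_def)
  define f where "f L = \<delta> *\<^sub>R (P L ** block_B L)" for L
  have cont_P: "continuous_on UNIV P" unfolding P_def by (intro continuous_intros)
  then have cont_f: "continuous_on UNIV f" unfolding f_def by (intro continuous_intros)
  have f: "qform (f (GL_act R L)) x = qform (f L) (transpose R *v x)" if "R \<in> GL" for R L x
  proof -
    have "P (GL_act R L) ** block_B (GL_act R L)
        = R ** P L ** (matrix_inv R ** R) ** block_B L ** transpose R"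
      unfolding P[OF that] by (simp add: GL_act_def matrix_mul_assoc)
    also have "matrix_inv R ** R = mat 1"
      using that by (simp add: matrix_inv_inverse GL_def)
    finally have "f (GL_act R L) = transpose (transpose R) ** f L ** transpose R"
      by (simp add: f_def matrix_mult_distribs matrix_mul_assoc)
    then show ?thesis by (simp only: qform_congruence)
  qed
  have "0 \<le> qform (f z) x" for x
    by (rule qform_nonneg_closure[OF z(2) cont_f])
      (use M in \<open>auto simp: orbit_def f, simp add: f_def qform_scaleR\<close>)
  moreover have "0 \<le> qform (- f z) x" for x
    by (rule qform_nonneg_closure[OF z(3)], intro continuous_intros cont_f)
      (use M' in \<open>auto simp: orbit_def f qform_minus, simp add: f_def qform_scaleR\<close>)
  ultimately have q0: "qform (f z) x = 0" for x
    by (simp add: qform_minus order_antisym)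
  obtain A B C where ABC: "z = M_ABC A B C" using z(1) by (rule SpI_imp_M_ABC)
  have eqs: "transpose B = B" "A ** B = B ** transpose A" "A ** A - B ** C = mat 1"
    using z(1) unfolding ABC SpI_iff by blast+
  have "transpose (f z) = f z"
    unfolding f_def P_def ABC
    by (simp add: transpose_scalar transpose_distribs matrix_transpose_mul matrix_mult_distribs eqs)
  then have "f z = 0" using q0 by (rule qform_eq_0_imp_eq_0)
  then have PB: "P z ** B = 0" using \<delta> by (simp add: f_def ABC)
  \<comment> \<open>The relation (A - \<nu>)(A - \<mu>) = 0 is conjugation invariant and closed, so
    it reaches z. With PB = 0, multiplying A^2 - BC = I by P on the left then gives P = \<mu>^2
    P.\<close>
  have PA: "P z ** A = \<mu> *\<^sub>R P z"
  proof -
    have "P z ** block_A z - \<mu> *\<^sub>R P z \<in> {0}"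
    proof (rule closure_map_in_closed[OF z(2)])
      show "continuous_on UNIV (\<lambda>L. P L ** block_A L - \<mu> *\<^sub>R P L)"
        by (intro continuous_intros cont_P)
      show "P u ** block_A u - \<mu> *\<^sub>R P u \<in> {0}" if u: "u \<in> orbit GL GL_act M" for u
      proof -
        obtain R where R: "R \<in> GL" "u = GL_act R M" using u unfolding orbit_def by blast
        have "block_A u = R ** block_A M ** matrix_inv R" by (simp add: R(2) GL_act_def)
        then have "P u ** block_A u = R ** (P M ** block_A M) ** matrix_inv R"
          using R(1) unfolding R(2) P[OF R(1)] by (simp add: conjugate_mult GL_def)
        then show ?thesis by (simp add: rel R P matrix_mult_distribs)
      qed
    qed simp
    then show ?thesis by (simp add: ABC)
  qed
  have "P z = P z ** (A ** A - B ** C)" by (simp add: eqs(3))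
  also have "\<dots> = (P z ** A) ** A - (P z ** B) ** C"
    by (simp add: matrix_mult_distribs matrix_mul_assoc)
  also have "\<dots> = \<mu>\<^sup>2 *\<^sub>R P z"
    by (simp add: PA PB matrix_mult_distribs power2_eq_square matrix_mult.zero_left)
  finally have "(\<mu>\<^sup>2 - 1) *\<^sub>R P z = 0" by (simp add: scaleR_diff_left)
  then have "A = \<nu> *\<^sub>R mat 1" using \<mu> by (simp add: P_def ABC)
  moreover have "trace (block_A z) \<in> {trace (block_A M)}"
    by (rule closure_map_in_closed[OF z(2)], intro continuous_intros)
      (auto simp: orbit_def GL_act_def GL_def trace_conjugate)
  ultimately show ?thesis by (simp add: ABC trace_def mat_def mult.commute)
qed

text \<open>A scalar A is fixed by conjugation, so it persists at z. There BC = (\<mu>^2 - 1)I makes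
  B invertible, and a nondegenerate limit of semidefinite forms excludes nearby forms with a
  negative direction.\<close>

lemma SpI_definite_obstruction:
  assumes z: "z \<in> SpI" "z \<in> closure (orbit GL GL_act M)" "z \<in> closure (orbit GL GL_act M')"
    and A: "block_A M = \<mu> *\<^sub>R mat 1" and \<mu>: "\<mu>\<^sup>2 \<noteq> 1"
    and M: "\<And>x. 0 \<le> \<delta> * qform (block_B M) x"
    and M': "\<delta> * qform (block_B M') y < 0"
  shows False
proof -
  have qf: "qform (\<delta> *\<^sub>R block_B (GL_act R L)) x = \<delta> * qform (block_B L) (transpose R *v x)" for R L x
    using qform_congruence[of "transpose R" "block_B L" x] by (simp add: GL_act_def qform_scaleR)
  obtain A B C where ABC: "z = M_ABC A B C" using z(1) by (rule SpI_imp_M_ABC)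
  have eqs: "transpose B = B" "transpose C = C" "A ** A - B ** C = mat 1"
    using z(1) unfolding ABC SpI_iff by blast+
  have "block_A z \<in> {\<mu> *\<^sub>R mat 1}"
    by (rule closure_map_in_closed[OF z(2)], intro continuous_intros)
      (auto simp: orbit_def GL_act_def GL_def A conjugate_mat_1)
  then have "A = \<mu> *\<^sub>R mat 1" by (simp add: ABC)
  then have "B ** C = (\<mu>\<^sup>2 - 1) *\<^sub>R mat 1"
    using eqs(3) by (simp add: matrix_mult_distribs power2_eq_square algebra_simps)
  then have CB: "C ** B = (\<mu>\<^sup>2 - 1) *\<^sub>R mat 1"
    by (metis eqs(1,2) matrix_transpose_mul transpose_mat transpose_scalar)
  have \<delta>: "\<delta> \<noteq> 0" using M' by auto
  show False
  proof (rule nondegenerate_limit_definite[OF z(2,3), of "\<lambda>L. \<delta> *\<^sub>R block_B L"])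
    show "continuous_on UNIV (\<lambda>L. \<delta> *\<^sub>R block_B L)" by (intro continuous_intros)
    show "0 \<le> qform (\<delta> *\<^sub>R block_B u) x" if "u \<in> orbit GL GL_act M" for u x
      using that M by (auto simp: orbit_def qf)
    show "\<exists>x. qform (\<delta> *\<^sub>R block_B v) x < 0" if v: "v \<in> orbit GL GL_act M'" for v
    proof -
      obtain R where R: "R \<in> GL" "v = GL_act R M'" using v unfolding orbit_def by blast
      have "transpose R *v (matrix_inv (transpose R) *v y) = y"
        using R(1) by (simp add: matrix_vector_mul_assoc matrix_inv_inverse GL_def transpose_invertible
            del: transpose_matrix_vector)
      then have "qform (\<delta> *\<^sub>R block_B v) (matrix_inv (transpose R) *v y) < 0"
        unfolding R(2) qf using M' by simp
      then show ?thesis by blast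
    qed
    show "transpose (\<delta> *\<^sub>R block_B z) = \<delta> *\<^sub>R block_B z"
      by (simp add: ABC transpose_scalar eqs)
    show "x = 0" if "(\<delta> *\<^sub>R block_B z) *v x = 0" for x
    proof -
      have "B *v x = 0" using that \<delta> by (simp add: ABC matrix_vector_mult.scaleR_left)
      then have "(C ** B) *v x = 0" by (simp flip: matrix_vector_mul_assoc)
      then show ?thesis using \<mu> by (simp add: CB matrix_vector_mult.scaleR_left)
    qed
  qed
qed

section \<open>Krein-type forms and their limits under conjugation\<close>

section \<open>Sign obstructions for symplectic conjugation\<close>

definition sp_sum :: "'n::finite bmat \<Rightarrow> 'n bmat" where
  "sp_sum M = M + sp_inv M"

definition sp_diff :: "'n::finite bmat \<Rightarrow> 'n bmat" where
  "sp_diff M = M - sp_inv M"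

lemma continuous_on_sp_sum_diff [continuous_intros]:
  assumes "continuous_on S f"
  shows "continuous_on S (\<lambda>x. sp_sum (f x))" "continuous_on S (\<lambda>x. sp_diff (f x))"
  unfolding sp_sum_def sp_diff_def using assms by (intro continuous_intros; assumption)+

lemma sp_sum_diff_conj:
  assumes "S \<in> Sp" "M \<in> Sp"
  shows "sp_sum (Sp_conj S M) = S ** sp_sum M ** matrix_inv S"
    "sp_diff (Sp_conj S M) = S ** sp_diff M ** matrix_inv S"
  unfolding sp_sum_def sp_diff_def sp_inv_conj[OF assms]
  by (simp_all add: Sp_conj_def matrix_mult_distribs)

lemma J_mat_mult_Sp:
  assumes "S \<in> Sp"
  shows "J_mat ** S = transpose (matrix_inv S) ** J_mat"
proof -
  have "J_mat ** S = (transpose (matrix_inv S) ** J_mat ** matrix_inv S) ** S"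
    using Sp_matrix_inv[OF assms] by (simp add: Sp_def)
  also have "\<dots> = transpose (matrix_inv S) ** J_mat ** (matrix_inv S ** S)"
    by (simp only: matrix_mul_assoc)
  finally show ?thesis by (simp add: matrix_inv_inverse Sp_invertible assms)
qed

text \<open>Since JS = S^-T J for symplectic S, multiplication by J turns conjugation into
  congruence.\<close>

lemma qform_J_conj:
  assumes "S \<in> Sp"
  shows "qform (J_mat ** (S ** X ** matrix_inv S)) x = qform (J_mat ** X) (matrix_inv S *v x)"
proof -
  have "J_mat ** (S ** X ** matrix_inv S) = transpose (matrix_inv S) ** (J_mat ** X) ** matrix_inv S"
    by (simp only: matrix_mul_assoc J_mat_mult_Sp[OF assms])
  then show ?thesis by (simp only: qform_congruence)
qed

lemma transpose_Sp_J:
  assumes "M \<in> Sp"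
  shows "transpose M ** J_mat = J_mat ** sp_inv M" "transpose (sp_inv M) ** J_mat = J_mat ** M"
proof -
  show "transpose M ** J_mat = J_mat ** sp_inv M"
    by (simp add: sp_inv_def matrix_mult_distribs matrix_mul_assoc J_mat_square)
  show "transpose (sp_inv M) ** J_mat = J_mat ** M"
    using J_mat_mult_Sp[OF assms] by (simp add: matrix_inv_Sp assms)
qed

lemma transpose_J_sp_diff:
  assumes "M \<in> Sp"
  shows "transpose (J_mat ** sp_diff M) = J_mat ** sp_diff M"
  by (simp add: sp_diff_def matrix_transpose_mul transpose_J_mat matrix_mult_distribs
      transpose_distribs transpose_Sp_J[OF assms])

lemma transpose_sp_sum_J:
  assumes "M \<in> Sp"
  shows "transpose (sp_sum M) ** J_mat = J_mat ** sp_sum M"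
  by (simp add: sp_sum_def matrix_mult_distribs transpose_distribs transpose_Sp_J[OF assms])

lemma sp_sum_diff_commute:
  assumes "M \<in> Sp"
  shows "sp_sum M ** sp_diff M = sp_diff M ** sp_sum M"
  by (simp add: sp_sum_def sp_diff_def matrix_mult_distribs sp_inv_left sp_inv_right assms)

lemma sp_diff_square:
  assumes "M \<in> Sp"
  shows "sp_diff M ** sp_diff M = sp_sum M ** sp_sum M - 4 *\<^sub>R mat 1"
proof -
  have "(4::real) *\<^sub>R (mat 1 :: 'a bmat) = mat 1 + mat 1 + mat 1 + mat 1"
    by (simp add: vec_eq_iff)
  then show ?thesis
    by (simp add: sp_sum_def sp_diff_def matrix_mult_distribs sp_inv_left sp_inv_right assms)
qed

lemma J_mat_mult_eq_0: "J_mat ** X = 0 \<Longrightarrow> X = 0"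
  by (metis J_mat_square matrix_mul_assoc matrix_mul_lid matrix_mult.minus_left matrix_mult.zero_right
      neg_equal_0_iff_equal)

text \<open>At the common limit the form vanishes, that is KP = 0 for K = \<open>sp_diff z\<close>.
  Applying K once more and using K^2 = T^2 - 4I with TP = \<tau>P leaves (\<tau>^2 - 4)P = 0, hence
  P = 0.\<close>

lemma Sp_sign_obstruction:
  fixes M M' :: "'n::finite bmat" and \<nu> :: real
  defines "P \<equiv> \<lambda>L. sp_sum L - \<nu> *\<^sub>R mat 1"
  assumes z: "z \<in> Sp" "z \<in> closure (orbit Sp Sp_conj M)" "z \<in> closure (orbit Sp Sp_conj M')"
    and Sp: "M \<in> Sp" "M' \<in> Sp"
    and rel: "sp_sum M ** P M = \<tau> *\<^sub>R P M" and \<tau>: "\<tau>\<^sup>2 \<noteq> 4"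
    and M: "\<And>x. 0 \<le> \<delta> * qform (J_mat ** (sp_diff M ** P M)) x"
    and M': "\<And>x. \<delta> * qform (J_mat ** (sp_diff M' ** P M')) x \<le> 0" and \<delta>: "\<delta> \<noteq> 0"
  shows "trace (sp_sum M) = \<nu> * real CARD('n + 'n)"
proof -
  have P: "P (Sp_conj S L) = S ** P L ** matrix_inv S" if "S \<in> Sp" "L \<in> Sp" for S L
    using that by (simp add: P_def sp_sum_diff_conj matrix_mult_distribs matrix_inv_inverse Sp_invertible)
  define f where "f L = \<delta> *\<^sub>R (J_mat ** (sp_diff L ** P L))" for L
  have cont_P: "continuous_on UNIV P" unfolding P_def by (intro continuous_intros)
  then have cont_f: "continuous_on UNIV f" unfolding f_def by (intro continuous_intros)
  have f: "qform (f (Sp_conj S L)) x = qform (f L) (matrix_inv S *v x)" if "S \<in> Sp" "L \<in> Sp" for S L x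
    unfolding f_def qform_scaleR P[OF that] sp_sum_diff_conj[OF that]
      conjugate_mult[OF Sp_invertible[OF that(1)]] qform_J_conj[OF that(1)] by (rule refl)
  have "0 \<le> qform (f z) x" for x
    by (rule qform_nonneg_closure[OF z(2) cont_f])
      (use M Sp in \<open>auto simp: orbit_def f, simp add: f_def qform_scaleR\<close>)
  moreover have "0 \<le> qform (- f z) x" for x
    by (rule qform_nonneg_closure[OF z(3)], intro continuous_intros cont_f)
      (use M' Sp in \<open>auto simp: orbit_def f qform_minus, simp add: f_def qform_scaleR\<close>)
  ultimately have q0: "qform (f z) x = 0" for x
    by (simp add: qform_minus order_antisym)
  \<comment> \<open>JK is symmetric, T satisfies T^T J = JT, and T commutes with K; together these
    make JK(T - \<nu>) symmetric.\<close>
  have "transpose (f z) = f z"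
  proof -
    have "transpose (J_mat ** (sp_diff z ** P z)) = transpose (P z) ** transpose (J_mat ** sp_diff z)"
      by (simp only: matrix_mul_assoc matrix_transpose_mul)
    also have "\<dots> = transpose (P z) ** J_mat ** sp_diff z"
      by (simp add: transpose_J_sp_diff z matrix_mul_assoc)
    also have "transpose (P z) ** J_mat = J_mat ** P z"
      by (simp add: P_def transpose_distribs matrix_mult_distribs transpose_sp_sum_J z)
    also have "J_mat ** P z ** sp_diff z = J_mat ** (sp_diff z ** P z)"
      by (simp add: P_def matrix_mul_assoc[symmetric] matrix_mult_distribs sp_sum_diff_commute z)
    finally show ?thesis by (simp add: f_def transpose_scalar)
  qed
  then have "f z = 0" using q0 by (rule qform_eq_0_imp_eq_0)
  then have KP: "sp_diff z ** P z = 0" using \<delta> J_mat_mult_eq_0 by (auto simp: f_def)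
  have TP: "sp_sum z ** P z = \<tau> *\<^sub>R P z"
  proof -
    have "sp_sum z ** P z - \<tau> *\<^sub>R P z \<in> {0}"
    proof (rule closure_map_in_closed[OF z(2)])
      show "continuous_on UNIV (\<lambda>L. sp_sum L ** P L - \<tau> *\<^sub>R P L)"
        by (intro continuous_intros cont_P)
      show "sp_sum u ** P u - \<tau> *\<^sub>R P u \<in> {0}" if u: "u \<in> orbit Sp Sp_conj M" for u
      proof -
        obtain S where S: "S \<in> Sp" "u = Sp_conj S M" using u unfolding orbit_def by blast
        have "sp_sum u ** P u = S ** (sp_sum M ** P M) ** matrix_inv S"
          unfolding S(2) P[OF S(1) Sp(1)] sp_sum_diff_conj(1)[OF S(1) Sp(1)]
          by (rule conjugate_mult[OF Sp_invertible[OF S(1)]])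
        then show ?thesis by (simp add: rel S P Sp matrix_mult_distribs)
      qed
    qed simp
    then show ?thesis by simp
  qed
  have "0 = sp_diff z ** (sp_diff z ** P z)" by (simp add: KP matrix_mult.zero_right)
  also have "\<dots> = sp_sum z ** (sp_sum z ** P z) - 4 *\<^sub>R P z"
    by (simp add: matrix_mul_assoc sp_diff_square z matrix_mult_distribs)
  also have "\<dots> = (\<tau>\<^sup>2 - 4) *\<^sub>R P z"
    by (simp add: TP matrix_mult_distribs power2_eq_square scaleR_diff_left)
  finally have "sp_sum z = \<nu> *\<^sub>R mat 1" using \<tau> by (simp add: P_def)
  moreover have "trace (sp_sum z) \<in> {trace (sp_sum M)}"
    by (rule closure_map_in_closed[OF z(2)], intro continuous_intros)
      (auto simp: orbit_def sp_sum_diff_conj Sp Sp_invertible trace_conjugate)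
  ultimately show ?thesis by (simp add: trace_def mat_def mult.commute)
qed

text \<open>A scalar T persists at z, and K^2 = (\<tau>^2 - 4)I then keeps JK nondegenerate
  there.\<close>

lemma Sp_definite_obstruction:
  assumes z: "z \<in> Sp" "z \<in> closure (orbit Sp Sp_conj M)" "z \<in> closure (orbit Sp Sp_conj M')"
    and Sp: "M \<in> Sp" "M' \<in> Sp"
    and T: "sp_sum M = \<tau> *\<^sub>R mat 1" and \<tau>: "\<tau>\<^sup>2 \<noteq> 4"
    and M: "\<And>x. 0 \<le> \<delta> * qform (J_mat ** sp_diff M) x"
    and M': "\<delta> * qform (J_mat ** sp_diff M') y < 0"
  shows False
proof -
  have \<delta>: "\<delta> \<noteq> 0" using M' by auto
  have qf: "qform (\<delta> *\<^sub>R (J_mat ** sp_diff (Sp_conj S L))) x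
      = \<delta> * qform (J_mat ** sp_diff L) (matrix_inv S *v x)" if "S \<in> Sp" "L \<in> Sp" for S L x
    by (simp add: qform_scaleR sp_sum_diff_conj[OF that] qform_J_conj[OF that(1)])
  have "sp_sum z \<in> {\<tau> *\<^sub>R mat 1}"
    by (rule closure_map_in_closed[OF z(2)], intro continuous_intros)
      (auto simp: orbit_def sp_sum_diff_conj Sp T conjugate_mat_1 Sp_invertible)
  then have KK: "sp_diff z ** sp_diff z = (\<tau>\<^sup>2 - 4) *\<^sub>R mat 1"
    by (simp add: sp_diff_square z matrix_mult_distribs power2_eq_square scaleR_diff_left)
  show False
  proof (rule nondegenerate_limit_definite[OF z(2,3), of "\<lambda>L. \<delta> *\<^sub>R (J_mat ** sp_diff L)"])
    show "continuous_on UNIV (\<lambda>L. \<delta> *\<^sub>R (J_mat ** sp_diff L))" by (intro continuous_intros)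
    show "0 \<le> qform (\<delta> *\<^sub>R (J_mat ** sp_diff u)) x" if "u \<in> orbit Sp Sp_conj M" for u x
      using that M Sp by (auto simp: orbit_def qf)
    show "\<exists>x. qform (\<delta> *\<^sub>R (J_mat ** sp_diff v)) x < 0" if v: "v \<in> orbit Sp Sp_conj M'" for v
    proof -
      obtain S where S: "S \<in> Sp" "v = Sp_conj S M'" using v unfolding orbit_def by blast
      have "matrix_inv S *v (S *v y) = y"
        using S(1) by (simp add: matrix_vector_mul_assoc matrix_inv_inverse Sp_invertible)
      then have "qform (\<delta> *\<^sub>R (J_mat ** sp_diff v)) (S *v y) < 0"
        unfolding S(2) qf[OF S(1) Sp(2)] using M' by simp
      then show ?thesis by blast
    qed
    show "transpose (\<delta> *\<^sub>R (J_mat ** sp_diff z)) = \<delta> *\<^sub>R (J_mat ** sp_diff z)"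
      by (simp add: transpose_scalar transpose_J_sp_diff z)
    show "x = 0" if "(\<delta> *\<^sub>R (J_mat ** sp_diff z)) *v x = 0" for x
    proof -
      have "J_mat *v (sp_diff z *v x) = 0"
        using that \<delta> by (simp add: matrix_vector_mult.scaleR_left matrix_vector_mul_assoc)
      then have "(J_mat ** J_mat) *v (sp_diff z *v x) = 0"
        by (simp flip: matrix_vector_mul_assoc)
      then have "sp_diff z *v x = 0"
        by (simp add: J_mat_square matrix_vector_mult.minus_left)
      then have "(sp_diff z ** sp_diff z) *v x = 0" by (simp flip: matrix_vector_mul_assoc)
      then show ?thesis using \<tau> by (simp add: KK matrix_vector_mult.scaleR_left)
    qed
  qed
qed

section \<open>Which signs of the normal forms are visible in each quotient\<close>

section \<open>Comparing the normal forms\<close>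

lemma qform_mat22_diagonal: "qform (mat22 a 0 0 b) x = a * (x $ 1)\<^sup>2 + b * (x $ 2)\<^sup>2"
  by (simp add: qform_def inner_vec_def matrix_vector_mult_def sum_2 power2_eq_square)

lemma qform_block_diagonal:
  "qform (block (mat22 a 0 0 b) 0 0 (mat22 c 0 0 d)) x =
     a * (x $ Inl 1)\<^sup>2 + b * (x $ Inl 2)\<^sup>2 + c * (x $ Inr 1)\<^sup>2 + d * (x $ Inr 2)\<^sup>2"
  by (simp add: qform_def inner_vec_def matrix_vector_mult_def sum_UNIV_Plus sum_2 power2_eq_square)

lemma N_real_blocks:
  "block_A (N_real \<mu>1 \<epsilon>1 \<mu>2 \<epsilon>2) = mat22 \<mu>1 0 0 \<mu>2"
  "block_B (N_real \<mu>1 \<epsilon>1 \<mu>2 \<epsilon>2) = mat22 (\<epsilon>1 * s_of \<mu>1) 0 0 (\<epsilon>2 * s_of \<mu>2)"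
  by (simp_all add: N_real_def)

lemma N_complex_trace_det:
  "trace (block_A (N_complex r \<theta>)) = 2 * r * cos \<theta>" "det (block_A (N_complex r \<theta>)) = r\<^sup>2"
proof -
  show "trace (block_A (N_complex r \<theta>)) = 2 * r * cos \<theta>"
    by (simp add: N_complex_def Let_def trace_mat22)
  have "det (block_A (N_complex r \<theta>)) = r\<^sup>2 * ((sin \<theta>)\<^sup>2 + (cos \<theta>)\<^sup>2)"
    by (simp add: N_complex_def Let_def det_mat22 power2_eq_square algebra_simps
        del: sin_cos_squared_add sin_cos_squared_add2 sin_cos_squared_add3)
  then show "det (block_A (N_complex r \<theta>)) = r\<^sup>2" by simp
qed

lemma N_real_Sp: "\<epsilon>1 \<in> {1, -1} \<Longrightarrow> \<epsilon>2 \<in> {1, -1} \<Longrightarrow> N_real \<mu>1 \<epsilon>1 \<mu>2 \<epsilon>2 \<in> Sp"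
  using N_real_SpI by (auto simp: SpI_def)

lemma sp_inv_N_real:
  "sp_inv (N_real \<mu>1 \<epsilon>1 \<mu>2 \<epsilon>2) = block (mat22 \<mu>1 0 0 \<mu>2)
     (- mat22 (\<epsilon>1 * s_of \<mu>1) 0 0 (\<epsilon>2 * s_of \<mu>2))
     (- mat22 (\<sigma>_of \<mu>1 * \<epsilon>1 * s_of \<mu>1) 0 0 (\<sigma>_of \<mu>2 * \<epsilon>2 * s_of \<mu>2)) (mat22 \<mu>1 0 0 \<mu>2)"
  by (simp add: N_real_def M_ABC_def sp_inv_def J_mat_def block_simps mat22_transpose
      matrix_mult_distribs)

lemma sp_sum_N_real:
  "sp_sum (N_real \<mu>1 \<epsilon>1 \<mu>2 \<epsilon>2) =
     block (mat22 (2 * \<mu>1) 0 0 (2 * \<mu>2)) 0 0 (mat22 (2 * \<mu>1) 0 0 (2 * \<mu>2))"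
  unfolding sp_sum_def sp_inv_N_real
  by (simp add: N_real_def M_ABC_def block_linear mat22_transpose mat22_linear zero_mat22)

lemma J_sp_diff_N_real:
  "J_mat ** sp_diff (N_real \<mu>1 \<epsilon>1 \<mu>2 \<epsilon>2) =
     block (mat22 (2 * \<sigma>_of \<mu>1 * \<epsilon>1 * s_of \<mu>1) 0 0 (2 * \<sigma>_of \<mu>2 * \<epsilon>2 * s_of \<mu>2)) 0 0
       (mat22 (- 2 * \<epsilon>1 * s_of \<mu>1) 0 0 (- 2 * \<epsilon>2 * s_of \<mu>2))"
  unfolding sp_diff_def sp_inv_N_real
  by (simp add: N_real_def M_ABC_def J_mat_def block_linear block_mult mat22_transpose mat22_linear
      matrix_mult_distribs mult_ac)

lemma sp_sum_N_real_shift: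
  "sp_sum (N_real \<mu>1 \<epsilon>1 \<mu>2 \<epsilon>2) - \<nu> *\<^sub>R mat 1 = block (mat22 (2 * \<mu>1 - \<nu>) 0 0 (2 * \<mu>2 - \<nu>)) 0 0
     (mat22 (2 * \<mu>1 - \<nu>) 0 0 (2 * \<mu>2 - \<nu>))"
  unfolding sp_sum_N_real mat_1_block by (simp add: block_linear mat_1_mat22 mat22_linear)

text \<open>Each plane contributes 2\<epsilon>s(2\<mu> - \<nu>)(\<sigma>x^2 - y^2), and \<nu> equal
  to twice the other eigenvalue removes the other plane. What is left is definite on its plane
  exactly in the elliptic case.\<close>

lemma krein_form_N_real:
  "qform (J_mat ** (sp_diff (N_real \<mu>1 \<epsilon>1 \<mu>2 \<epsilon>2) ** (sp_sum (N_real \<mu>1 \<epsilon>1 \<mu>2 \<epsilon>2) - \<nu> *\<^sub>R mat 1))) x =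
     2 * (\<sigma>_of \<mu>1 * \<epsilon>1 * s_of \<mu>1 * (2 * \<mu>1 - \<nu>) * (x $ Inl 1)\<^sup>2
        + \<sigma>_of \<mu>2 * \<epsilon>2 * s_of \<mu>2 * (2 * \<mu>2 - \<nu>) * (x $ Inl 2)\<^sup>2
        - \<epsilon>1 * s_of \<mu>1 * (2 * \<mu>1 - \<nu>) * (x $ Inr 1)\<^sup>2 - \<epsilon>2 * s_of \<mu>2 * (2 * \<mu>2 - \<nu>) * (x $ Inr 2)\<^sup>2)"
  unfolding matrix_mul_assoc J_sp_diff_N_real sp_sum_N_real_shift
  by (simp add: block_mult mat22_mult qform_block_diagonal algebra_simps)

lemma elliptic_sigma_s:
  assumes "-1 < \<mu>" "\<mu> < 1"
  shows "\<sigma>_of \<mu> = -1" "0 < s_of \<mu>" "\<mu>\<^sup>2 \<noteq> 1"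
proof -
  have "\<mu>\<^sup>2 < 1" using assms by (simp add: abs_square_less_1 abs_less_iff)
  then show "\<sigma>_of \<mu> = -1" "0 < s_of \<mu>" "\<mu>\<^sup>2 \<noteq> 1" by (simp_all add: \<sigma>_of_def s_of_def)
qed

lemma nonelliptic_sigma_s:
  assumes "\<not> (-1 < \<mu> \<and> \<mu> < 1)"
  shows "\<sigma>_of \<mu> = 1 \<or> s_of \<mu> = 0"
proof -
  have "1 \<le> \<bar>\<mu>\<bar>" using assms by linarith
  then have "1 \<le> \<mu>\<^sup>2" using abs_le_square_iff[of 1 \<mu>] by simp
  then show ?thesis by (auto simp: \<sigma>_of_def s_of_def)
qed

text \<open>Opposite values of the tested sign would, by the obstruction, make the trace twice the
  other eigenvalue, against \<mu>1 < \<mu>2.\<close>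

lemma SpI_class_N_real_distinct:
  assumes \<epsilon>: "\<epsilon>1 \<in> {1, -1}" "\<epsilon>2 \<in> {1, -1}" "\<epsilon>1' \<in> {1, -1}" "\<epsilon>2' \<in> {1, -1}" and \<mu>: "\<mu>1 < \<mu>2"
    and eq: "SpI_class (N_real \<mu>1 \<epsilon>1 \<mu>2 \<epsilon>2) = SpI_class (N_real \<mu>1 \<epsilon>1' \<mu>2 \<epsilon>2')"
  shows "\<mu>1\<^sup>2 \<noteq> 1 \<Longrightarrow> \<epsilon>1 = \<epsilon>1'" "\<mu>2\<^sup>2 \<noteq> 1 \<Longrightarrow> \<epsilon>2 = \<epsilon>2'"
proof -
  let ?N = "N_real \<mu>1 \<epsilon>1 \<mu>2 \<epsilon>2" and ?N' = "N_real \<mu>1 \<epsilon>1' \<mu>2 \<epsilon>2'"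
  have SpI: "?N' \<in> SpI" using \<epsilon> by (simp add: N_real_SpI)
  obtain z where z: "z \<in> SpI" "z \<in> closure (orbit GL GL_act ?N)" "z \<in> closure (orbit GL GL_act ?N')"
    using eq unfolding SpI_class_def by (rule git_class_eqE[OF _ SpI in_orbit_GL[OF SpI]])
  show "\<epsilon>1 = \<epsilon>1'" if "\<mu>1\<^sup>2 \<noteq> 1"
  proof (rule ccontr)
    assume "\<epsilon>1 \<noteq> \<epsilon>1'"
    then have opp: "\<epsilon>1' = - \<epsilon>1" "\<epsilon>1 * \<epsilon>1 = 1" "\<epsilon>1 \<noteq> 0" using \<epsilon> by auto
    \<comment> \<open>Stated for arbitrary signs so that it evaluates both normal forms. The factor
      -\<epsilon>1 compensates for \<mu>1 - \<mu>2 < 0.\<close>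
    have qf: "- \<epsilon>1 * qform ((block_A (N_real \<mu>1 \<epsilon> \<mu>2 \<epsilon>'') - \<mu>2 *\<^sub>R mat 1) ** block_B (N_real \<mu>1 \<epsilon> \<mu>2 \<epsilon>'')) x
        = (\<epsilon>1 * \<epsilon>) * ((\<mu>2 - \<mu>1) * s_of \<mu>1 * (x $ 1)\<^sup>2)" for \<epsilon> \<epsilon>'' x
      by (simp add: N_real_blocks mat_1_mat22 mat22_linear mat22_mult qform_mat22_diagonal algebra_simps)
    have pos: "0 \<le> (\<mu>2 - \<mu>1) * s_of \<mu>1 * (x $ 1)\<^sup>2" for x :: "real^2"
      using \<mu> s_of_nonneg by simp
    have "trace (block_A ?N) = \<mu>2 * real CARD(2)"
      by (rule SpI_sign_obstruction[OF z _ \<open>\<mu>1\<^sup>2 \<noteq> 1\<close>, where \<delta> = "- \<epsilon>1"], unfold qf)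
        (use opp pos in \<open>simp_all add: N_real_blocks mat_1_mat22 mat22_linear mat22_mult mat22_eq_iff\<close>)
    then show False using \<mu> by (simp add: N_real_blocks trace_mat22)
  qed
  show "\<epsilon>2 = \<epsilon>2'" if "\<mu>2\<^sup>2 \<noteq> 1"
  proof (rule ccontr)
    assume "\<epsilon>2 \<noteq> \<epsilon>2'"
    then have opp: "\<epsilon>2' = - \<epsilon>2" "\<epsilon>2 * \<epsilon>2 = 1" "\<epsilon>2 \<noteq> 0" using \<epsilon> by auto
    have qf: "\<epsilon>2 * qform ((block_A (N_real \<mu>1 \<epsilon>'' \<mu>2 \<epsilon>) - \<mu>1 *\<^sub>R mat 1) ** block_B (N_real \<mu>1 \<epsilon>'' \<mu>2 \<epsilon>)) x
        = (\<epsilon>2 * \<epsilon>) * ((\<mu>2 - \<mu>1) * s_of \<mu>2 * (x $ 2)\<^sup>2)" for \<epsilon> \<epsilon>'' x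
      by (simp add: N_real_blocks mat_1_mat22 mat22_linear mat22_mult qform_mat22_diagonal algebra_simps)
    have pos: "0 \<le> (\<mu>2 - \<mu>1) * s_of \<mu>2 * (x $ 2)\<^sup>2" for x :: "real^2"
      using \<mu> s_of_nonneg by simp
    have "trace (block_A ?N) = \<mu>1 * real CARD(2)"
      by (rule SpI_sign_obstruction[OF z _ \<open>\<mu>2\<^sup>2 \<noteq> 1\<close>, where \<delta> = "\<epsilon>2"], unfold qf)
        (use opp pos in \<open>simp_all add: N_real_blocks mat_1_mat22 mat22_linear mat22_mult mat22_eq_iff\<close>)
    then show False using \<mu> by (simp add: N_real_blocks trace_mat22)
  qed
qed

lemma SpI_class_N_real_definite:
  assumes \<epsilon>: "\<epsilon> \<in> {1, -1}" "\<epsilon>1' \<in> {1, -1}" "\<epsilon>2' \<in> {1, -1}" and \<mu>: "\<mu>\<^sup>2 \<noteq> 1"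
    and eq: "SpI_class (N_real \<mu> \<epsilon> \<mu> \<epsilon>) = SpI_class (N_real \<mu> \<epsilon>1' \<mu> \<epsilon>2')"
  shows "\<epsilon>1' = \<epsilon> \<and> \<epsilon>2' = \<epsilon>"
proof (rule ccontr)
  assume neg: "\<not> (\<epsilon>1' = \<epsilon> \<and> \<epsilon>2' = \<epsilon>)"
  let ?N = "N_real \<mu> \<epsilon> \<mu> \<epsilon>" and ?N' = "N_real \<mu> \<epsilon>1' \<mu> \<epsilon>2'"
  have SpI: "?N' \<in> SpI" using \<epsilon> by (simp add: N_real_SpI)
  obtain z where z: "z \<in> SpI" "z \<in> closure (orbit GL GL_act ?N)" "z \<in> closure (orbit GL GL_act ?N')"
    using eq unfolding SpI_class_def by (rule git_class_eqE[OF _ SpI in_orbit_GL[OF SpI]])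
  have s: "0 < s_of \<mu>" using \<mu> s_of_nonneg[of \<mu>] s_of_eq_0_iff[of \<mu>] by linarith
  \<comment> \<open>A coordinate direction on which the second form has the sign opposite to
    \<epsilon>.\<close>
  define y :: "real^2" where "y = (if \<epsilon>1' = \<epsilon> then axis 2 1 else axis 1 1)"
  have "\<epsilon> * qform (block_B ?N') y < 0"
    using neg \<epsilon> s by (auto simp: N_real_blocks qform_mat22_diagonal y_def axis_def)
  moreover have "0 \<le> \<epsilon> * qform (block_B ?N) x" for x
    using \<epsilon> s by (auto simp: N_real_blocks qform_mat22_diagonal)
  moreover have "block_A ?N = \<mu> *\<^sub>R mat 1"
    by (simp add: N_real_blocks mat_1_mat22 mat22_linear)
  ultimately show False
    using SpI_definite_obstruction[OF z _ \<mu>] by blast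
qed

lemma Sp_class_N_real_distinct:
  assumes \<epsilon>: "\<epsilon>1 \<in> {1, -1}" "\<epsilon>2 \<in> {1, -1}" "\<epsilon>1' \<in> {1, -1}" "\<epsilon>2' \<in> {1, -1}" and \<mu>: "\<mu>1 < \<mu>2"
    and eq: "Sp_class (N_real \<mu>1 \<epsilon>1 \<mu>2 \<epsilon>2) = Sp_class (N_real \<mu>1 \<epsilon>1' \<mu>2 \<epsilon>2')"
  shows "-1 < \<mu>1 \<Longrightarrow> \<mu>1 < 1 \<Longrightarrow> \<epsilon>1 = \<epsilon>1'" "-1 < \<mu>2 \<Longrightarrow> \<mu>2 < 1 \<Longrightarrow> \<epsilon>2 = \<epsilon>2'"
proof -
  let ?N = "N_real \<mu>1 \<epsilon>1 \<mu>2 \<epsilon>2" and ?N' = "N_real \<mu>1 \<epsilon>1' \<mu>2 \<epsilon>2'"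
  have Sp: "?N \<in> Sp" "?N' \<in> Sp" using \<epsilon> by (simp_all add: N_real_Sp)
  obtain z where z: "z \<in> Sp" "z \<in> closure (orbit Sp Sp_conj ?N)" "z \<in> closure (orbit Sp Sp_conj ?N')"
    using eq unfolding Sp_class_def by (rule git_class_eqE[OF _ Sp(2) in_orbit_Sp])
  have rel: "sp_sum ?N ** (sp_sum ?N - (2 * \<mu>2) *\<^sub>R mat 1) = (2 * \<mu>1) *\<^sub>R (sp_sum ?N - (2 * \<mu>2) *\<^sub>R mat 1)"
    "sp_sum ?N ** (sp_sum ?N - (2 * \<mu>1) *\<^sub>R mat 1) = (2 * \<mu>2) *\<^sub>R (sp_sum ?N - (2 * \<mu>1) *\<^sub>R mat 1)"
    unfolding sp_sum_N_real_shift unfolding sp_sum_N_real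
    by (simp_all add: block_mult block_linear mat22_mult mat22_linear block_eq_iff mat22_eq_iff)
  show "\<epsilon>1 = \<epsilon>1'" if ell: "-1 < \<mu>1" "\<mu>1 < 1"
  proof (rule ccontr)
    assume "\<epsilon>1 \<noteq> \<epsilon>1'"
    then have opp: "\<epsilon>1' = - \<epsilon>1" "\<epsilon>1 * \<epsilon>1 = 1" "\<epsilon>1 \<noteq> 0" using \<epsilon> by auto
    \<comment> \<open>The value \<sigma> = -1 supplies one more sign change than in the linear case,
      so the factor is now +\<epsilon>1.\<close>
    have qf: "\<epsilon>1 * qform (J_mat ** (sp_diff (N_real \<mu>1 \<epsilon> \<mu>2 \<epsilon>'')
          ** (sp_sum (N_real \<mu>1 \<epsilon> \<mu>2 \<epsilon>'') - (2 * \<mu>2) *\<^sub>R mat 1))) x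
        = (\<epsilon>1 * \<epsilon>) * (4 * (s_of \<mu>1 * (\<mu>2 - \<mu>1)) * ((x $ Inl 1)\<^sup>2 + (x $ Inr 1)\<^sup>2))" for \<epsilon> \<epsilon>'' x
      unfolding krein_form_N_real by (simp add: elliptic_sigma_s[OF ell] algebra_simps)
    have pos: "0 \<le> 4 * (s_of \<mu>1 * (\<mu>2 - \<mu>1)) * ((x $ Inl 1)\<^sup>2 + (x $ Inr 1)\<^sup>2)" for x :: "real^(2+2)"
      using \<mu> s_of_nonneg by simp
    have "(2 * \<mu>1)\<^sup>2 \<noteq> 4" using elliptic_sigma_s(3)[OF ell] by (simp add: power_mult_distrib)
    then have "trace (sp_sum ?N) = 2 * \<mu>2 * real CARD(2 + 2)"
      by (rule Sp_sign_obstruction[OF z Sp rel(1), where \<delta> = "\<epsilon>1"], unfold qf)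
        (use opp pos in simp_all)
    then show False using \<mu> by (simp add: sp_sum_N_real trace_block trace_mat22)
  qed
  show "\<epsilon>2 = \<epsilon>2'" if ell: "-1 < \<mu>2" "\<mu>2 < 1"
  proof (rule ccontr)
    assume "\<epsilon>2 \<noteq> \<epsilon>2'"
    then have opp: "\<epsilon>2' = - \<epsilon>2" "\<epsilon>2 * \<epsilon>2 = 1" "\<epsilon>2 \<noteq> 0" using \<epsilon> by auto
    have qf: "- \<epsilon>2 * qform (J_mat ** (sp_diff (N_real \<mu>1 \<epsilon>'' \<mu>2 \<epsilon>)
          ** (sp_sum (N_real \<mu>1 \<epsilon>'' \<mu>2 \<epsilon>) - (2 * \<mu>1) *\<^sub>R mat 1))) x
        = (\<epsilon>2 * \<epsilon>) * (4 * (s_of \<mu>2 * (\<mu>2 - \<mu>1)) * ((x $ Inl 2)\<^sup>2 + (x $ Inr 2)\<^sup>2))" for \<epsilon> \<epsilon>'' x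
      unfolding krein_form_N_real by (simp add: elliptic_sigma_s[OF ell] algebra_simps)
    have pos: "0 \<le> 4 * (s_of \<mu>2 * (\<mu>2 - \<mu>1)) * ((x $ Inl 2)\<^sup>2 + (x $ Inr 2)\<^sup>2)" for x :: "real^(2+2)"
      using \<mu> s_of_nonneg by simp
    have "(2 * \<mu>2)\<^sup>2 \<noteq> 4" using elliptic_sigma_s(3)[OF ell] by (simp add: power_mult_distrib)
    then have "trace (sp_sum ?N) = 2 * \<mu>1 * real CARD(2 + 2)"
      by (rule Sp_sign_obstruction[OF z Sp rel(2), where \<delta> = "- \<epsilon>2"], unfold qf)
        (use opp pos in simp_all)
    then show False using \<mu> by (simp add: sp_sum_N_real trace_block trace_mat22)
  qed
qed

lemma Sp_class_N_real_definite:
  assumes \<epsilon>: "\<epsilon> \<in> {1, -1}" "\<epsilon>1' \<in> {1, -1}" "\<epsilon>2' \<in> {1, -1}" and \<mu>: "-1 < \<mu>" "\<mu> < 1"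
    and eq: "Sp_class (N_real \<mu> \<epsilon> \<mu> \<epsilon>) = Sp_class (N_real \<mu> \<epsilon>1' \<mu> \<epsilon>2')"
  shows "\<epsilon>1' = \<epsilon> \<and> \<epsilon>2' = \<epsilon>"
proof (rule ccontr)
  assume neg: "\<not> (\<epsilon>1' = \<epsilon> \<and> \<epsilon>2' = \<epsilon>)"
  let ?N = "N_real \<mu> \<epsilon> \<mu> \<epsilon>" and ?N' = "N_real \<mu> \<epsilon>1' \<mu> \<epsilon>2'"
  have Sp: "?N \<in> Sp" "?N' \<in> Sp" using \<epsilon> by (simp_all add: N_real_Sp)
  obtain z where z: "z \<in> Sp" "z \<in> closure (orbit Sp Sp_conj ?N)" "z \<in> closure (orbit Sp Sp_conj ?N')"
    using eq unfolding Sp_class_def by (rule git_class_eqE[OF _ Sp(2) in_orbit_Sp])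
  note ell = elliptic_sigma_s[OF \<mu>]
  define y :: "real^(2 + 2)" where "y = (if \<epsilon>1' = \<epsilon> then axis (Inl 2) 1 else axis (Inl 1) 1)"
  have "- \<epsilon> * qform (J_mat ** sp_diff ?N') y < 0"
    unfolding J_sp_diff_N_real qform_block_diagonal
    using neg \<epsilon> ell by (auto simp: y_def axis_def)
  moreover have "0 \<le> - \<epsilon> * qform (J_mat ** sp_diff ?N) x" for x
  proof -
    have "- \<epsilon> * qform (J_mat ** sp_diff ?N) x = (\<epsilon> * \<epsilon>) * (2 * s_of \<mu> *
        ((x $ Inl 1)\<^sup>2 + (x $ Inl 2)\<^sup>2 + (x $ Inr 1)\<^sup>2 + (x $ Inr 2)\<^sup>2))"
      unfolding J_sp_diff_N_real qform_block_diagonal by (simp add: ell(1) algebra_simps)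
    then show ?thesis using ell(2) by simp
  qed
  moreover have "sp_sum ?N = (2 * \<mu>) *\<^sub>R mat 1"
    unfolding sp_sum_N_real mat_1_block by (simp add: block_linear mat_1_mat22 mat22_linear)
  moreover have "(2 * \<mu>)\<^sup>2 \<noteq> 4" using ell(3) by (simp add: power_mult_distrib)
  ultimately show False
    using Sp_definite_obstruction[OF z Sp] by blast
qed

text \<open>The symplectic matrix acting as \<open>J\<close> on the \<open>j\<close>-th hyperbolic plane flips
  \<open>\<epsilon>\<^sub>j\<close> when \<open>\<sigma>(\<mu>\<^sub>j) = 1\<close>.\<close>

lemma Sp_class_N_real_flip:
  assumes \<epsilon>: "\<epsilon>1 \<in> {1, -1}" "\<epsilon>2 \<in> {1, -1}" "\<epsilon>1' \<in> {1, -1}" "\<epsilon>2' \<in> {1, -1}"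
    and 1: "-1 < \<mu>1 \<and> \<mu>1 < 1 \<longrightarrow> \<epsilon>1 = \<epsilon>1'" and 2: "-1 < \<mu>2 \<and> \<mu>2 < 1 \<longrightarrow> \<epsilon>2 = \<epsilon>2'"
  shows "Sp_class (N_real \<mu>1 \<epsilon>1 \<mu>2 \<epsilon>2) = Sp_class (N_real \<mu>1 \<epsilon>1' \<mu>2 \<epsilon>2')"
proof -
  \<comment> \<open>The indicator of a flip: plane j of \<open>S\<close> carries the identity for e
    = 0 and J for e = 1. On an elliptic plane J commutes with the normal form, so it flips nothing
    there.\<close>
  define e :: "real \<Rightarrow> real \<Rightarrow> real" where "e \<epsilon> \<epsilon>' = (if \<epsilon> = \<epsilon>' then 0 else 1)" for \<epsilon> \<epsilon>'
  have e: "(e \<epsilon> \<epsilon>' = 0 \<and> \<epsilon>' = \<epsilon>) \<or> (e \<epsilon> \<epsilon>' = 1 \<and> \<epsilon>' = - \<epsilon> \<and> (\<sigma>_of \<mu> = 1 \<or> s_of \<mu> = 0))"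
    if "\<epsilon> \<in> {1, -1}" "\<epsilon>' \<in> {1, -1}" "-1 < \<mu> \<and> \<mu> < 1 \<longrightarrow> \<epsilon> = \<epsilon>'" for \<epsilon> \<epsilon>' \<mu>
    using that nonelliptic_sigma_s[of \<mu>] by (auto simp: e_def)
  define e1 e2 where "e1 = e \<epsilon>1 \<epsilon>1'" and "e2 = e \<epsilon>2 \<epsilon>2'"
  have e1: "(e1 = 0 \<and> \<epsilon>1' = \<epsilon>1) \<or> (e1 = 1 \<and> \<epsilon>1' = - \<epsilon>1 \<and> (\<sigma>_of \<mu>1 = 1 \<or> s_of \<mu>1 = 0))"
    and e2: "(e2 = 0 \<and> \<epsilon>2' = \<epsilon>2) \<or> (e2 = 1 \<and> \<epsilon>2' = - \<epsilon>2 \<and> (\<sigma>_of \<mu>2 = 1 \<or> s_of \<mu>2 = 0))"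
    unfolding e1_def e2_def using e[OF \<epsilon>(1,3) 1] e[OF \<epsilon>(2,4) 2] .
  define S where "S = block (mat22 (1 - e1) 0 0 (1 - e2)) (mat22 e1 0 0 e2)
    (mat22 (- e1) 0 0 (- e2)) (mat22 (1 - e1) 0 0 (1 - e2))"
  have "S \<in> Sp"
    unfolding Sp_def S_def J_mat_def using e1 e2
    by (auto simp: block_mult block_transpose mat22_simps block_eq_iff)
  moreover have "S ** N_real \<mu>1 \<epsilon>1 \<mu>2 \<epsilon>2 = N_real \<mu>1 \<epsilon>1' \<mu>2 \<epsilon>2' ** S"
    unfolding S_def N_real_def M_ABC_def block_mult mat22_transpose mat22_mult mat22_linear
      block_eq_iff mat22_eq_iff
    using e1 e2 by auto
  ultimately show ?thesis using \<epsilon> by (intro Sp_class_eqI[of S] N_real_Sp)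
qed

lemma Sp_class_N_real_swap:
  assumes "\<epsilon>1 \<in> {1, -1}" "\<epsilon>2 \<in> {1, -1}"
  shows "Sp_class (N_real \<mu> \<epsilon>1 \<mu> \<epsilon>2) = Sp_class (N_real \<mu> \<epsilon>2 \<mu> \<epsilon>1)"
proof (rule Sp_class_eqI[of "block (mat22 0 1 1 0) 0 0 (mat22 0 1 1 0)"])
  show "block (mat22 0 1 1 0) 0 0 (mat22 0 1 1 0) \<in> Sp"
    by (simp add: Sp_def J_mat_def block_mult block_transpose block_eq_iff mat22_simps)
  show "block (mat22 0 1 1 0) 0 0 (mat22 0 1 1 0) ** N_real \<mu> \<epsilon>1 \<mu> \<epsilon>2
      = N_real \<mu> \<epsilon>2 \<mu> \<epsilon>1 ** block (mat22 0 1 1 0) 0 0 (mat22 0 1 1 0)"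
    by (simp add: N_real_def M_ABC_def block_mult block_eq_iff mat22_simps)
qed (use assms in \<open>simp add: N_real_Sp\<close>)

lemma SpI_class_N_real_swap:
  assumes "\<epsilon>1 \<in> {1, -1}" "\<epsilon>2 \<in> {1, -1}"
  shows "SpI_class (N_real \<mu> \<epsilon>2 \<mu> \<epsilon>1) = SpI_class (N_real \<mu> \<epsilon>1 \<mu> \<epsilon>2)"
proof -
  have P: "mat22 0 1 1 0 \<in> GL" by (simp add: mat22_GL)
  have "GL_act (mat22 0 1 1 0) (N_real \<mu> \<epsilon>1 \<mu> \<epsilon>2) = N_real \<mu> \<epsilon>2 \<mu> \<epsilon>1"
    unfolding N_real_def by (rule GL_act_eqI[OF P]) (simp_all add: mat22_simps)
  then show ?thesis using SpI_class_GL_act[OF P N_real_SpI[OF assms], of \<mu> \<mu>] by simp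
qed

text \<open>Any two mixed pairs agree up to order, so it is enough to recognise pairs of equal
  signs, from either side.\<close>

lemma sign_pairs_eq_or_swap:
  fixes a b c d :: real
  assumes signs: "a \<in> {1, -1}" "b \<in> {1, -1}" "c \<in> {1, -1}" "d \<in> {1, -1}"
    and "a = b \<Longrightarrow> c = a \<and> d = a" "c = d \<Longrightarrow> a = c \<and> b = c"
  shows "c = a \<and> d = b \<or> c = b \<and> d = a"
proof (cases "a = b \<or> c = d")
  case True
  then show ?thesis using assms(5,6) by metis
next
  case False
  then show ?thesis using signs by auto
qed

lemma sum_prod_unique:
  fixes a b c d :: real
  assumes "a + b = c + d" "a * b = c * d" "a \<le> b" "c \<le> d"
  shows "a = c \<and> b = d"
proof -
  have "(a - c) * (a - d) = a * a - a * (c + d) + c * d" by (simp add: algebra_simps)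
  also have "\<dots> = 0" unfolding assms(1,2)[symmetric] by (simp add: algebra_simps)
  finally have "a = c \<or> a = d" by simp
  then show ?thesis using assms by auto
qed

text \<open>The discriminant would be both (\<mu>1 - \<mu>2)^2 and -(2r sin \<theta>)^2.\<close>

lemma real_complex_trace_det:
  fixes r \<theta> :: real
  assumes "0 < r" "0 < \<theta>" "\<theta> < pi" "\<mu>1 + \<mu>2 = 2 * r * cos \<theta>" "\<mu>1 * \<mu>2 = r\<^sup>2"
  shows False
proof -
  have "(\<mu>1 - \<mu>2)\<^sup>2 = (\<mu>1 + \<mu>2)\<^sup>2 - 4 * (\<mu>1 * \<mu>2)" by (simp add: power2_eq_square algebra_simps)
  also have "\<dots> = - (2 * r * sin \<theta>)\<^sup>2"
    unfolding assms(4,5) by (simp add: power_mult_distrib cos_squared_eq algebra_simps)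
  finally have "(2 * r * sin \<theta>)\<^sup>2 \<le> 0"
    by (metis neg_0_le_iff_le zero_le_power2)
  then show False using assms sin_gt_zero[of \<theta>] by simp
qed

section \<open>Existence of normal forms and the classification\<close>

lemma exists_normal_form:
  fixes M :: "2 bmat"
  assumes "M \<in> SpI"
  shows "\<exists>N \<in> real_forms \<union> complex_forms. degenerates_to M N"
proof -
  obtain A B C where M: "M = M_ABC A B C" using assms by (rule SpI_imp_M_ABC)
  define t d where "t = trace A / 2" and "d = det A"
  show ?thesis
  \<comment> \<open>With t half the trace, t^2 - d is a quarter of the discriminant; the real roots
    are t - w \<le> t + w.\<close>
  proof (cases "d \<le> t\<^sup>2")
    case True
    define w where "w = sqrt (t\<^sup>2 - d)"
    have w: "0 \<le> w" "w\<^sup>2 = t\<^sup>2 - d" using True by (simp_all add: w_def)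
    have "trace A = (t - w) + (t + w)" by (simp add: t_def)
    moreover have "det A = (t - w) * (t + w)"
      using w(2) by (simp add: d_def power2_eq_square algebra_simps)
    ultimately obtain \<epsilon>1 \<epsilon>2 where "\<epsilon>1 \<in> {1, -1}" "\<epsilon>2 \<in> {1, -1}"
      "degenerates_to M (N_real (t - w) \<epsilon>1 (t + w) \<epsilon>2)"
      using real_degenerates_to_N_real assms unfolding M by metis
    moreover have "t - w \<le> t + w" using w(1) by simp
    ultimately show ?thesis unfolding real_forms_def by blast
  next
    case False
    define r where "r = sqrt d"
    have d: "0 < d" using False by (smt (verit) zero_le_power2)
    then have r: "0 < r" "r\<^sup>2 = d" by (simp_all add: r_def)
    \<comment> \<open>The pair (t/r, y) is to be (cos \<theta>, sin \<theta>); y > 0 keeps \<theta>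
      strictly between 0 and \<pi>.\<close>
    define y where "y = sqrt (d - t\<^sup>2) / r"
    have y: "0 < y" using False r by (simp add: y_def)
    have "(t / r)\<^sup>2 + y\<^sup>2 = 1"
      using False r d by (simp add: y_def power_divide add_divide_distrib[symmetric])
    then obtain \<theta> where \<theta>: "0 \<le> \<theta>" "\<theta> \<le> pi" "t / r = cos \<theta>" "y = sin \<theta>"
      using sincos_total_pi[of y "t / r"] y by auto
    have "\<theta> \<noteq> 0" "\<theta> \<noteq> pi" using y \<theta>(4) by auto
    then have \<theta>': "0 < \<theta>" "\<theta> < pi" using \<theta> by auto
    have "trace A = 2 * r * cos \<theta>" using r by (simp add: \<theta>(3)[symmetric] t_def)
    moreover have "det A = r\<^sup>2" using r by (simp add: d_def)
    ultimately have "degenerates_to M (N_complex r \<theta>)"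
      using complex_degenerates_to_N_complex assms r(1) \<theta>' unfolding M by blast
    then show ?thesis using r(1) \<theta>' unfolding complex_forms_def by blast
  qed
qed

theorem mainTheorem3:
  shows
    (* (a) *)
    "(\<forall>c \<in> SpI_quotient. \<exists>N \<in> c. N \<in> real_forms \<union> complex_forms)
   \<and> (\<forall>A B C r \<theta>. M_ABC A B C \<in> SpI \<longrightarrow> 0 < r \<longrightarrow> 0 < \<theta> \<longrightarrow> \<theta> < pi \<longrightarrow>
        eigenvalues A = {of_real r * cis \<theta>, of_real r * cis (- \<theta>)} \<longrightarrow>
        SpI_class (M_ABC A B C) \<inter> complex_forms = {N_complex r \<theta>}
        \<and> SpI_class (M_ABC A B C) \<inter> real_forms = {})
   \<and> (\<forall>A B C \<mu>1 \<mu>2. M_ABC A B C \<in> SpI \<longrightarrow> \<mu>1 \<le> \<mu>2 \<longrightarrow>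
        eigenvalues A = {of_real \<mu>1, of_real \<mu>2} \<longrightarrow>
        SpI_class (M_ABC A B C) \<inter> (real_forms \<union> complex_forms)
          \<subseteq> {N_real \<mu>1 \<epsilon>1 \<mu>2 \<epsilon>2 | \<epsilon>1 \<epsilon>2. \<epsilon>1 \<in> {1, -1} \<and> \<epsilon>2 \<in> {1, -1}})
   \<and> (\<forall>\<mu>1 \<mu>2. \<forall>\<epsilon>1 \<in> {1, -1}. \<forall>\<epsilon>2 \<in> {1, -1}. \<forall>\<epsilon>1' \<in> {1, -1}. \<forall>\<epsilon>2' \<in> {1, -1}.
        \<mu>1 \<le> \<mu>2 \<longrightarrow>
        (SpI_class (N_real \<mu>1 \<epsilon>1 \<mu>2 \<epsilon>2) = SpI_class (N_real \<mu>1 \<epsilon>1' \<mu>2 \<epsilon>2')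
         \<longleftrightarrow> N_real \<mu>1 \<epsilon>1 \<mu>2 \<epsilon>2 = N_real \<mu>1 \<epsilon>1' \<mu>2 \<epsilon>2'
             \<or> \<mu>1 = \<mu>2 \<and> (\<epsilon>1', \<epsilon>2') = (\<epsilon>2, \<epsilon>1)))
   \<and> \<comment> \<open>(b)\<close>
     (\<forall>\<mu>1 \<mu>2. \<forall>\<epsilon>1 \<in> {1, -1}. \<forall>\<epsilon>2 \<in> {1, -1}. \<forall>\<epsilon>1' \<in> {1, -1}. \<forall>\<epsilon>2' \<in> {1, -1}.
        \<mu>1 < \<mu>2 \<longrightarrow>
        (Sp_class (N_real \<mu>1 \<epsilon>1 \<mu>2 \<epsilon>2) = Sp_class (N_real \<mu>1 \<epsilon>1' \<mu>2 \<epsilon>2')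
         \<longleftrightarrow> (-1 < \<mu>1 \<and> \<mu>1 < 1 \<longrightarrow> \<epsilon>1 = \<epsilon>1') \<and> (-1 < \<mu>2 \<and> \<mu>2 < 1 \<longrightarrow> \<epsilon>2 = \<epsilon>2')))
   \<and> (\<forall>\<mu>. \<forall>\<epsilon>1 \<in> {1, -1}. \<forall>\<epsilon>2 \<in> {1, -1}. \<forall>\<epsilon>1' \<in> {1, -1}. \<forall>\<epsilon>2' \<in> {1, -1}.
        -1 < \<mu> \<and> \<mu> < 1 \<longrightarrow>
        (Sp_class (N_real \<mu> \<epsilon>1 \<mu> \<epsilon>2) = Sp_class (N_real \<mu> \<epsilon>1' \<mu> \<epsilon>2')
         \<longleftrightarrow> {#\<epsilon>1, \<epsilon>2#} = {#\<epsilon>1', \<epsilon>2'#}))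
   \<and> (\<forall>\<mu>. \<forall>\<epsilon>1 \<in> {1, -1}. \<forall>\<epsilon>2 \<in> {1, -1}. \<forall>\<epsilon>1' \<in> {1, -1}. \<forall>\<epsilon>2' \<in> {1, -1}.
        1 \<le> \<bar>\<mu>\<bar> \<longrightarrow>
        Sp_class (N_real \<mu> \<epsilon>1 \<mu> \<epsilon>2) = Sp_class (N_real \<mu> \<epsilon>1' \<mu> \<epsilon>2'))"
proof (intro conjI allI ballI impI)
  fix c :: "2 bmat set" assume "c \<in> SpI_quotient"
  then obtain M where "M \<in> SpI" "c = SpI_class M"
    by (auto simp: SpI_quotient_def git_quotient_def quotient_def SpI_class_def git_class_def)
  then show "\<exists>N \<in> c. N \<in> real_forms \<union> complex_forms"
    using exists_normal_form degenerates_to_SpI_class by metis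
next
  fix A B C :: "2 mat" and r \<theta> :: real
  assume M: "M_ABC A B C \<in> SpI" and r: "0 < r" and \<theta>: "0 < \<theta>" "\<theta> < pi"
    and ev: "eigenvalues A = {of_real r * cis \<theta>, of_real r * cis (- \<theta>)}"
  have "complex_of_real (trace A) = of_real (2 * r * cos \<theta>)"
    unfolding eigenvalues_pair_trace_det(1)[OF ev] by (simp add: complex_eq_iff)
  moreover have "complex_of_real (det A) = of_real (r\<^sup>2)"
  proof -
    have "complex_of_real (det A) = of_real (r\<^sup>2) * (cis \<theta> * cis (- \<theta>))"
      unfolding eigenvalues_pair_trace_det(2)[OF ev]
      by (simp only: power2_eq_square of_real_mult mult_ac)
    then show ?thesis by (simp add: cis_mult)
  qed
  ultimately have tr: "trace A = 2 * r * cos \<theta>" and det: "det A = r\<^sup>2"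
    unfolding of_real_eq_iff .
  have inv: "trace (block_A N) = 2 * r * cos \<theta>" "det (block_A N) = r\<^sup>2"
    if "N \<in> SpI_class (M_ABC A B C)" for N
    using SpI_class_trace_det[OF that] by (simp_all add: tr det)
  have "N_complex r \<theta> \<in> SpI_class (M_ABC A B C)"
    by (intro degenerates_to_SpI_class complex_degenerates_to_N_complex M r \<theta> tr det)
  moreover have "N = N_complex r \<theta>" if cls: "N \<in> SpI_class (M_ABC A B C)" and form: "N \<in> complex_forms" for N
  proof -
    obtain r' \<theta>' where N: "N = N_complex r' \<theta>'" "0 < r'" "0 < \<theta>'" "\<theta>' < pi"
      using form unfolding complex_forms_def by blast
    \<comment> \<open>The determinant recovers r; the trace then recovers \<theta>, cos being
      injective on [0, \<pi>].\<close>
    have "r'\<^sup>2 = r\<^sup>2" "2 * r' * cos \<theta>' = 2 * r * cos \<theta>"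
      using inv[OF cls] unfolding N(1) N_complex_trace_det by simp_all
    then have "r' = r" and cos: "cos \<theta>' = cos \<theta>"
      using r N(2) by simp_all
    moreover have "\<theta>' = \<theta>" by (rule cos_inj_pi[OF _ _ _ _ cos]) (use \<theta> N in auto)
    ultimately show ?thesis by (simp add: N(1))
  qed
  ultimately show "SpI_class (M_ABC A B C) \<inter> complex_forms = {N_complex r \<theta>}"
    using r \<theta> unfolding complex_forms_def by blast
  show "SpI_class (M_ABC A B C) \<inter> real_forms = {}"
  proof (rule ccontr)
    assume "SpI_class (M_ABC A B C) \<inter> real_forms \<noteq> {}"
    then obtain \<mu>1 \<epsilon>1 \<mu>2 \<epsilon>2 where "N_real \<mu>1 \<epsilon>1 \<mu>2 \<epsilon>2 \<in> SpI_class (M_ABC A B C)"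
      unfolding real_forms_def by blast
    from inv[OF this] have "\<mu>1 + \<mu>2 = 2 * r * cos \<theta>" "\<mu>1 * \<mu>2 = r\<^sup>2"
      by (simp_all add: N_real_blocks trace_mat22 det_mat22)
    then show False using real_complex_trace_det r \<theta> by blast
  qed
next
  fix A B C :: "2 mat" and \<mu>1 \<mu>2 :: real
  assume M: "M_ABC A B C \<in> SpI" and \<mu>: "\<mu>1 \<le> \<mu>2"
    and ev: "eigenvalues A = {of_real \<mu>1, of_real \<mu>2}"
  have "complex_of_real (trace A) = of_real (\<mu>1 + \<mu>2)" "complex_of_real (det A) = of_real (\<mu>1 * \<mu>2)"
    unfolding eigenvalues_pair_trace_det[OF ev] by simp_all
  then have tr: "trace A = \<mu>1 + \<mu>2" and det: "det A = \<mu>1 * \<mu>2"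
    unfolding of_real_eq_iff .
  show "SpI_class (M_ABC A B C) \<inter> (real_forms \<union> complex_forms)
      \<subseteq> {N_real \<mu>1 \<epsilon>1 \<mu>2 \<epsilon>2 | \<epsilon>1 \<epsilon>2. \<epsilon>1 \<in> {1, -1} \<and> \<epsilon>2 \<in> {1, -1}}"
  proof
    fix N assume N: "N \<in> SpI_class (M_ABC A B C) \<inter> (real_forms \<union> complex_forms)"
    have inv: "trace (block_A N) = \<mu>1 + \<mu>2" "det (block_A N) = \<mu>1 * \<mu>2"
      using SpI_class_trace_det[of N "M_ABC A B C"] N by (simp_all add: tr det)
    have "N \<notin> complex_forms"
    proof
      assume "N \<in> complex_forms"
      then obtain r \<theta> where "N = N_complex r \<theta>" "0 < r" "0 < \<theta>" "\<theta> < pi"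
        unfolding complex_forms_def by blast
      then show False
        using inv real_complex_trace_det[of r \<theta> \<mu>1 \<mu>2] by (simp add: N_complex_trace_det)
    qed
    then obtain \<nu>1 \<epsilon>1 \<nu>2 \<epsilon>2 where N': "N = N_real \<nu>1 \<epsilon>1 \<nu>2 \<epsilon>2" "\<nu>1 \<le> \<nu>2"
      "\<epsilon>1 \<in> {1, -1}" "\<epsilon>2 \<in> {1, -1}"
      using N unfolding real_forms_def by blast
    have "\<nu>1 = \<mu>1 \<and> \<nu>2 = \<mu>2"
      using inv N'(2) \<mu> by (intro sum_prod_unique) (simp_all add: N' N_real_blocks trace_mat22 det_mat22)
    then show "N \<in> {N_real \<mu>1 \<epsilon>1 \<mu>2 \<epsilon>2 | \<epsilon>1 \<epsilon>2. \<epsilon>1 \<in> {1, -1} \<and> \<epsilon>2 \<in> {1, -1}}"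
      using N' by blast
  qed
next
  fix \<mu>1 \<mu>2 \<epsilon>1 \<epsilon>2 \<epsilon>1' \<epsilon>2' :: real
  assume \<epsilon>: "\<epsilon>1 \<in> {1, -1}" "\<epsilon>2 \<in> {1, -1}" "\<epsilon>1' \<in> {1, -1}" "\<epsilon>2' \<in> {1, -1}" and \<mu>: "\<mu>1 \<le> \<mu>2"
  show "SpI_class (N_real \<mu>1 \<epsilon>1 \<mu>2 \<epsilon>2) = SpI_class (N_real \<mu>1 \<epsilon>1' \<mu>2 \<epsilon>2')
         \<longleftrightarrow> N_real \<mu>1 \<epsilon>1 \<mu>2 \<epsilon>2 = N_real \<mu>1 \<epsilon>1' \<mu>2 \<epsilon>2'
             \<or> \<mu>1 = \<mu>2 \<and> (\<epsilon>1', \<epsilon>2') = (\<epsilon>2, \<epsilon>1)" (is "?eq \<longleftrightarrow> ?same \<or> ?swap")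
  proof
    assume eq: ?eq
    show "?same \<or> ?swap"
    proof (cases "\<mu>1 = \<mu>2")
      case False
      then have "\<mu>1 < \<mu>2" using \<mu> by simp
      note signs = SpI_class_N_real_distinct[OF \<epsilon> this eq]
      \<comment> \<open>A sign that the classes do not detect has \<mu>^2 = 1, where s = 0 removes
        it from the matrix.\<close>
      have "\<epsilon>1 * s_of \<mu>1 = \<epsilon>1' * s_of \<mu>1" "\<epsilon>2 * s_of \<mu>2 = \<epsilon>2' * s_of \<mu>2"
        using signs s_of_eq_0_iff by (metis mult_zero_right)+
      then have ?same by (auto simp: N_real_def)
      then show ?thesis ..
    next
      case True
      show ?thesis
      proof (cases "\<mu>2\<^sup>2 = 1")
        case 1: True
        then have "s_of \<mu>2 = 0" by (simp add: s_of_eq_0_iff)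
        then show ?thesis using True by (simp add: N_real_def)
      next
        case ne: False
        have "\<epsilon>1 = \<epsilon>2 \<Longrightarrow> \<epsilon>1' = \<epsilon>1 \<and> \<epsilon>2' = \<epsilon>1"
          using SpI_class_N_real_definite[of \<epsilon>2 \<epsilon>1' \<epsilon>2' \<mu>2] eq \<epsilon> ne True by simp
        moreover have "\<epsilon>1' = \<epsilon>2' \<Longrightarrow> \<epsilon>1 = \<epsilon>1' \<and> \<epsilon>2 = \<epsilon>1'"
          using SpI_class_N_real_definite[of \<epsilon>2' \<epsilon>1 \<epsilon>2 \<mu>2] eq[symmetric] \<epsilon> ne True by simp
        ultimately have "\<epsilon>1' = \<epsilon>1 \<and> \<epsilon>2' = \<epsilon>2 \<or> \<epsilon>1' = \<epsilon>2 \<and> \<epsilon>2' = \<epsilon>1"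
          by (rule sign_pairs_eq_or_swap[OF \<epsilon>])
        then show ?thesis using True by blast
      qed
    qed
  next
    assume "?same \<or> ?swap"
    then show ?eq using SpI_class_N_real_swap[OF \<epsilon>(1,2)] by auto
  qed
next
  fix \<mu>1 \<mu>2 \<epsilon>1 \<epsilon>2 \<epsilon>1' \<epsilon>2' :: real
  assume \<epsilon>: "\<epsilon>1 \<in> {1, -1}" "\<epsilon>2 \<in> {1, -1}" "\<epsilon>1' \<in> {1, -1}" "\<epsilon>2' \<in> {1, -1}" and \<mu>: "\<mu>1 < \<mu>2"
  show "Sp_class (N_real \<mu>1 \<epsilon>1 \<mu>2 \<epsilon>2) = Sp_class (N_real \<mu>1 \<epsilon>1' \<mu>2 \<epsilon>2')
         \<longleftrightarrow> (-1 < \<mu>1 \<and> \<mu>1 < 1 \<longrightarrow> \<epsilon>1 = \<epsilon>1') \<and> (-1 < \<mu>2 \<and> \<mu>2 < 1 \<longrightarrow> \<epsilon>2 = \<epsilon>2')"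
    using Sp_class_N_real_distinct[OF \<epsilon> \<mu>] Sp_class_N_real_flip[OF \<epsilon>, of \<mu>1 \<mu>2] by blast
next
  fix \<mu> \<epsilon>1 \<epsilon>2 \<epsilon>1' \<epsilon>2' :: real
  assume \<epsilon>: "\<epsilon>1 \<in> {1, -1}" "\<epsilon>2 \<in> {1, -1}" "\<epsilon>1' \<in> {1, -1}" "\<epsilon>2' \<in> {1, -1}" and \<mu>: "-1 < \<mu> \<and> \<mu> < 1"
  show "Sp_class (N_real \<mu> \<epsilon>1 \<mu> \<epsilon>2) = Sp_class (N_real \<mu> \<epsilon>1' \<mu> \<epsilon>2')
         \<longleftrightarrow> {#\<epsilon>1, \<epsilon>2#} = {#\<epsilon>1', \<epsilon>2'#}" (is "?eq \<longleftrightarrow> ?mset")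
  proof
    assume eq: ?eq
    have "\<epsilon>1 = \<epsilon>2 \<Longrightarrow> \<epsilon>1' = \<epsilon>1 \<and> \<epsilon>2' = \<epsilon>1"
      using Sp_class_N_real_definite[of \<epsilon>2 \<epsilon>1' \<epsilon>2' \<mu>] eq \<epsilon> \<mu> by simp
    moreover have "\<epsilon>1' = \<epsilon>2' \<Longrightarrow> \<epsilon>1 = \<epsilon>1' \<and> \<epsilon>2 = \<epsilon>1'"
      using Sp_class_N_real_definite[of \<epsilon>2' \<epsilon>1 \<epsilon>2 \<mu>] eq[symmetric] \<epsilon> \<mu> by simp
    ultimately have "\<epsilon>1' = \<epsilon>1 \<and> \<epsilon>2' = \<epsilon>2 \<or> \<epsilon>1' = \<epsilon>2 \<and> \<epsilon>2' = \<epsilon>1"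
      by (rule sign_pairs_eq_or_swap[OF \<epsilon>])
    then show ?mset by auto
  next
    assume ?mset
    then have "\<epsilon>1' = \<epsilon>1 \<and> \<epsilon>2' = \<epsilon>2 \<or> \<epsilon>1' = \<epsilon>2 \<and> \<epsilon>2' = \<epsilon>1"
      by (auto simp: add_eq_conv_ex)
    then show ?eq using Sp_class_N_real_swap[OF \<epsilon>(1,2)] by auto
  qed
next
  fix \<mu> \<epsilon>1 \<epsilon>2 \<epsilon>1' \<epsilon>2' :: real
  assume \<epsilon>: "\<epsilon>1 \<in> {1, -1}" "\<epsilon>2 \<in> {1, -1}" "\<epsilon>1' \<in> {1, -1}" "\<epsilon>2' \<in> {1, -1}" and \<mu>: "1 \<le> \<bar>\<mu>\<bar>"
  \<comment> \<open>With |\<mu>| \<ge> 1 neither plane is elliptic, so each sign can be flipped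
    freely.\<close>
  show "Sp_class (N_real \<mu> \<epsilon>1 \<mu> \<epsilon>2) = Sp_class (N_real \<mu> \<epsilon>1' \<mu> \<epsilon>2')"
    using \<mu> by (intro Sp_class_N_real_flip \<epsilon>) linarith+
qed

end
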